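(* Let $\Gamma=(V,T,\mathbf{s},\mathbf{r})$ be a network with $|T|>1$, and let $t,q\in T$ be such that $o(\mathbf{r}(t))=0$, $\mathbf{r}(t)\neq\mathbf{r}(q)$, and there does not exist $A\in T^0\setminus V$ with $\mathbf{r}(t)\subseteq A$. Then $S_\Gamma$ is not $*$-congruence-free as a unary semigroup, and also $R_\Gamma$ is not congruence-free.
   Context: A network $\Gamma=(V,T,\mathbf{s},\mathbf{r})$ consists of a set $V$ of vertices, a set $T$ of relations, and maps $\mathbf{s},\mathbf{r}:T\to\mathcal{P}(V)$ such that for every $t\in T$ the sets $\mathbf{s}(t)$ and $\mathbf{r}(t)$ are disjoint non-empty subsets of $V$; $V$ and $T$ are finite or countably infinite. A vertex $v$ is identified with the singleton $\{v\}$. Put $T^0=\{A\subseteq V: A=\mathbf{s}(t)\text{ or }A=\mathbf{r}(t)\text{ for some }t\in T\}\cup V$ (so $T^0\setminus V$ consists of the non-singleton sources and ranges), and set $\mathbf{s}(A)=A=\mathbf{r}(A)$ for $A\in T^0$. For $A\subseteq V$, $o(A)$ is the cardinality of $\{t\in T:\mathbf{s}(t)=A\}$. For each $t\in T$ let $t^{-1}$ be a formal symbol with $\mathbf{s}(t^{-1})=\mathbf{r}(t)$, $\mathbf{r}(t^{-1})=\mathbf{s}(t)$; put $A^{-1}=A$ for $A\in T^0$ and $T^{-1}=\{t^{-1}:t\in T\}$. The symbol sets $T$, $T^0$, $T^{-1}$, $\{0\}$ are pairwise disjoint. $Q_\Gamma$ is the semigroup generated by $X=T\cup T^0\cup T^{-1}\cup\{0\}$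 subject to the relations: (NR1) $\mathbf{s}(t)t=t=t\mathbf{r}(t)$ for $t\in T\cup T^0\cup T^{-1}$; (NR2) $t_1t_2=0$ if $\mathbf{r}(t_1)\cap\mathbf{s}(t_2)=\emptyset$, for $t_1,t_2\in T\cup T^0\cup T^{-1}$; (NR3) $t_1^{-1}t_2=0$ if $t_1\neq t_2$, for $t_1,t_2\in T$; (NR4) $t^{-1}t=\mathbf{r}(t)$ for $t\in T$; (NR5) $t^{-1}A=0$ if $\mathbf{s}(t)\neq A$, for $t\in T$, $A\in T^0$; (NR6) $0x=0=x0$ for all $x\in X$. $[w]$ denotes the class in $Q_\Gamma$ of a word $w$. A non-zero path is a finite non-empty sequence $\alpha=t_1\cdots t_n$ with $t_i\in T\cup T^0$ and $\mathbf{r}(t_i)\cap\mathbf{s}(t_{i+1})\neq\emptyset$ for $1\le i<n$; $\mathbf{s}(\alpha)=\mathbf{s}(t_1)$, $\mathbf{r}(\alpha)=\mathbf{r}(t_n)$, $\alpha^{-1}=t_n^{-1}\cdots t_1^{-1}$. It is linear if $\mathbf{r}(t_i)=\mathbf{s}(t_{i+1})$ for $1\le i<n$, and reduced if $t_i\neq\mathbf{s}(t_{i+1})$ and $t_{i+1}\neq\mathbf{r}(t_i)$ for $1\le i<n$. $RP(\Gamma)$ is the set of reduced paths (together with $0$) and $RLP(\Gamma)$ the set of non-zero reduced linear paths. $S_\Gamma=\{[\alpha\beta^{-1}]\in Q_\Gamma:\alpha\in RP(\Gamma)\setminus\{0\},\ \beta\in RLP(\Gamma)\setminus T^0,\ \mathbf{r}(\alpha)=\mathbf{r}(\beta)\}\cup\{[0]\}$,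 a subsemigroup of $Q_\Gamma$, and $R_\Gamma=\{[\alpha\beta^{-1}]\in S_\Gamma:\alpha,\beta\in RLP(\Gamma)\setminus T^0,\ \mathbf{r}(\alpha)=\mathbf{r}(\beta)\}\cup\{[0]\}$, an inverse subsemigroup of $S_\Gamma$. For $a,b$ in a semigroup $S$, $a\,\mathcal{L}^*\,b$ means: for all $x,y\in S^1$, $ax=ay\Leftrightarrow bx=by$. $S$ is right $*$-abundant if each $\mathcal{L}^*$-class contains a unique idempotent; $a^*$ denotes the idempotent in the $\mathcal{L}^*$-class of $a$, and $S$ is regarded as a unary semigroup with the operation $a\mapsto a^*$. $S_\Gamma$ is right $*$-abundant. A unary semigroup congruence is a semigroup congruence $\rho$ such that $a\,\rho\,b$ implies $a^*\,\rho\,b^*$. A right $*$-abundant semigroup is $*$-congruence-free if its only unary semigroup congruences are the identity and the universal congruence. A semigroup is congruence-free if its only congruences are the identity and the universal congruence. *)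

theory Defs
  imports Main "HOL-Library.Extended_Nat" "HOL-Library.Countable_Set"
begin

section \<open>Semigroups given by a carrier set and a multiplication\<close>

definition semigroup_on :: "'a set \<Rightarrow> ('a \<Rightarrow> 'a \<Rightarrow> 'a) \<Rightarrow> bool" where
  "semigroup_on S m \<longleftrightarrow>
     (\<forall>a\<in>S. \<forall>b\<in>S. m a b \<in> S) \<and> (\<forall>a\<in>S. \<forall>b\<in>S. \<forall>c\<in>S. m (m a b) c = m a (m b c))"

definition sg_congruence :: "'a set \<Rightarrow> ('a \<Rightarrow> 'a \<Rightarrow> 'a) \<Rightarrow> ('a \<times> 'a) set \<Rightarrow> bool" where
  "sg_congruence S m \<rho> \<longleftrightarrow> equiv S \<rho> \<and>
     (\<forall>a b c. (a, b) \<in> \<rho> \<and> c \<in> S \<longrightarrow> (m c a, m c b) \<in> \<rho> \<and> (m a c, m b c) \<in> \<rho>)"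

definition congruence_free :: "'a set \<Rightarrow> ('a \<Rightarrow> 'a \<Rightarrow> 'a) \<Rightarrow> bool" where
  "congruence_free S m \<longleftrightarrow> (\<forall>\<rho>. sg_congruence S m \<rho> \<longrightarrow> \<rho> = Id_on S \<or> \<rho> = S \<times> S)"

definition unary_sg_congruence ::
  "'a set \<Rightarrow> ('a \<Rightarrow> 'a \<Rightarrow> 'a) \<Rightarrow> ('a \<Rightarrow> 'a) \<Rightarrow> ('a \<times> 'a) set \<Rightarrow> bool" where
  "unary_sg_congruence S m f \<rho> \<longleftrightarrow>
     sg_congruence S m \<rho> \<and> (\<forall>a b. (a, b) \<in> \<rho> \<longrightarrow> (f a, f b) \<in> \<rho>)"

text \<open>The set \<open>S\<^sup>1\<close>: \<^term>\<open>None\<close> is the adjoined identity, present only if \<open>S\<close> has no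
  identity of its own. Only products with the left factor in \<open>S\<close> are needed.\<close>

definition adjoin_one :: "'a set \<Rightarrow> ('a \<Rightarrow> 'a \<Rightarrow> 'a) \<Rightarrow> 'a option set" where
  "adjoin_one S m =
     (if \<exists>e\<in>S. \<forall>x\<in>S. m e x = x \<and> m x e = x then Some ` S else insert None (Some ` S))"

fun mult_one :: "('a \<Rightarrow> 'a \<Rightarrow> 'a) \<Rightarrow> 'a \<Rightarrow> 'a option \<Rightarrow> 'a" where
  "mult_one m a None = a"
| "mult_one m a (Some x) = m a x"

definition Lstar :: "'a set \<Rightarrow> ('a \<Rightarrow> 'a \<Rightarrow> 'a) \<Rightarrow> 'a \<Rightarrow> 'a \<Rightarrow> bool" where
  "Lstar S m a b \<longleftrightarrow> (\<forall>x\<in>adjoin_one S m. \<forall>y\<in>adjoin_one S m.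
     mult_one m a x = mult_one m a y \<longleftrightarrow> mult_one m b x = mult_one m b y)"

definition right_star_abundant :: "'a set \<Rightarrow> ('a \<Rightarrow> 'a \<Rightarrow> 'a) \<Rightarrow> bool" where
  "right_star_abundant S m \<longleftrightarrow> (\<forall>a\<in>S. \<exists>!e. e \<in> S \<and> m e e = e \<and> Lstar S m a e)"

definition star :: "'a set \<Rightarrow> ('a \<Rightarrow> 'a \<Rightarrow> 'a) \<Rightarrow> 'a \<Rightarrow> 'a" where
  "star S m a = (THE e. e \<in> S \<and> m e e = e \<and> Lstar S m a e)"

text \<open>This notion is meant for semigroups satisfying \<^const>\<open>right_star_abundant\<close>. Abundance is deliberately not a
  conjunct: its negation then asserts that there is a unary congruence other than the identity
  and the universal one, and cannot hold merely because abundance fails.\<close>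

definition star_congruence_free :: "'a set \<Rightarrow> ('a \<Rightarrow> 'a \<Rightarrow> 'a) \<Rightarrow> bool" where
  "star_congruence_free S m \<longleftrightarrow>
     (\<forall>\<rho>. unary_sg_congruence S m (star S m) \<rho> \<longrightarrow> \<rho> = Id_on S \<or> \<rho> = S \<times> S)"


section \<open>Semigroup presentations\<close>

definition free_words :: "'x set \<Rightarrow> 'x list set" where
  "free_words X = {w. w \<noteq> [] \<and> set w \<subseteq> X}"

text \<open>The least congruence on the free semigroup over \<open>X\<close> that contains \<open>R\<close>
  (for \<open>R\<close> a relation between words over \<open>X\<close>).\<close>

inductive pres_cong :: "'x set \<Rightarrow> ('x list \<Rightarrow> 'x list \<Rightarrow> bool) \<Rightarrow> 'x list \<Rightarrow> 'x list \<Rightarrow> bool"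
  for X :: "'x set" and R :: "'x list \<Rightarrow> 'x list \<Rightarrow> bool" where
  base: "R u v \<Longrightarrow> pres_cong X R u v"
| refl: "w \<in> free_words X \<Longrightarrow> pres_cong X R w w"
| sym: "pres_cong X R u v \<Longrightarrow> pres_cong X R v u"
| trans: "pres_cong X R u v \<Longrightarrow> pres_cong X R v w \<Longrightarrow> pres_cong X R u w"
| mult: "pres_cong X R u u' \<Longrightarrow> pres_cong X R v v' \<Longrightarrow> pres_cong X R (u @ v) (u' @ v')"


section \<open>Networks\<close>

record ('v, 't) network_data =
  verts :: "'v set"
  rels :: "'t set"
  source :: "'t \<Rightarrow> 'v set"
  target :: "'t \<Rightarrow> 'v set"

text \<open>\<^const>\<open>target\<close> is the map \<open>r\<close> (``range'').\<close>

definition network :: "('v, 't) network_data \<Rightarrow> bool" where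
  "network \<Gamma> \<longleftrightarrow> countable (verts \<Gamma>) \<and> countable (rels \<Gamma>) \<and>
     (\<forall>t\<in>rels \<Gamma>. source \<Gamma> t \<subseteq> verts \<Gamma> \<and> source \<Gamma> t \<noteq> {} \<and>
                target \<Gamma> t \<subseteq> verts \<Gamma> \<and> target \<Gamma> t \<noteq> {} \<and>
                source \<Gamma> t \<inter> target \<Gamma> t = {})"

text \<open>A vertex \<open>v\<close> is identified with \<open>{v}\<close>.\<close>

definition vertex_sets :: "('v, 't) network_data \<Rightarrow> 'v set set" where
  "vertex_sets \<Gamma> = (\<lambda>v. {v}) ` verts \<Gamma>"

definition T0 :: "('v, 't) network_data \<Rightarrow> 'v set set" where
  "T0 \<Gamma> = source \<Gamma> ` rels \<Gamma> \<union> target \<Gamma> ` rels \<Gamma> \<union> vertex_sets \<Gamma>"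

text \<open>\<^const>\<open>card\<close> is \<open>0\<close> on infinite sets, which would make ``\<open>o(A) = 0\<close>'' ambiguous.\<close>

definition ecard :: "'a set \<Rightarrow> enat" where
  "ecard A = (if finite A then enat (card A) else \<infinity>)"

definition outdeg :: "('v, 't) network_data \<Rightarrow> 'v set \<Rightarrow> enat" where
  "outdeg \<Gamma> A = ecard {t \<in> rels \<Gamma>. source \<Gamma> t = A}"


section \<open>The semigroup of a network\<close>

datatype ('v, 't) letter = Rel 't | Obj "'v set" | Inv 't | Zero

fun lsource :: "('v, 't) network_data \<Rightarrow> ('v, 't) letter \<Rightarrow> 'v set" where
  "lsource \<Gamma> (Rel t) = source \<Gamma> t"
| "lsource \<Gamma> (Obj A) = A"
| "lsource \<Gamma> (Inv t) = target \<Gamma> t"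
| "lsource \<Gamma> Zero = {}"  \<comment> \<open>irrelevant value\<close>

fun ltarget :: "('v, 't) network_data \<Rightarrow> ('v, 't) letter \<Rightarrow> 'v set" where
  "ltarget \<Gamma> (Rel t) = target \<Gamma> t"
| "ltarget \<Gamma> (Obj A) = A"
| "ltarget \<Gamma> (Inv t) = source \<Gamma> t"
| "ltarget \<Gamma> Zero = {}"  \<comment> \<open>irrelevant value\<close>

fun linv :: "('v, 't) letter \<Rightarrow> ('v, 't) letter" where
  "linv (Rel t) = Inv t"
| "linv (Obj A) = Obj A"
| "linv (Inv t) = Rel t"
| "linv Zero = Zero"

definition nz_letters :: "('v, 't) network_data \<Rightarrow> ('v, 't) letter set" where
  "nz_letters \<Gamma> = Rel ` rels \<Gamma> \<union> Obj ` T0 \<Gamma> \<union> Inv ` rels \<Gamma>"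

definition letters :: "('v, 't) network_data \<Rightarrow> ('v, 't) letter set" where
  "letters \<Gamma> = nz_letters \<Gamma> \<union> {Zero}"

inductive net_rel :: "('v, 't) network_data \<Rightarrow> ('v, 't) letter list \<Rightarrow> ('v, 't) letter list \<Rightarrow> bool"
  for \<Gamma> :: "('v, 't) network_data" where
  NR1_source: "x \<in> nz_letters \<Gamma> \<Longrightarrow> net_rel \<Gamma> [Obj (lsource \<Gamma> x), x] [x]"
| NR1_target: "x \<in> nz_letters \<Gamma> \<Longrightarrow> net_rel \<Gamma> [x, Obj (ltarget \<Gamma> x)] [x]"
| NR2: "x \<in> nz_letters \<Gamma> \<Longrightarrow> y \<in> nz_letters \<Gamma> \<Longrightarrow> ltarget \<Gamma> x \<inter> lsource \<Gamma> y = {} \<Longrightarrow>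
    net_rel \<Gamma> [x, y] [Zero]"
| NR3: "t \<in> rels \<Gamma> \<Longrightarrow> u \<in> rels \<Gamma> \<Longrightarrow> t \<noteq> u \<Longrightarrow> net_rel \<Gamma> [Inv t, Rel u] [Zero]"
| NR4: "t \<in> rels \<Gamma> \<Longrightarrow> net_rel \<Gamma> [Inv t, Rel t] [Obj (target \<Gamma> t)]"
| NR5: "t \<in> rels \<Gamma> \<Longrightarrow> A \<in> T0 \<Gamma> \<Longrightarrow> source \<Gamma> t \<noteq> A \<Longrightarrow> net_rel \<Gamma> [Inv t, Obj A] [Zero]"
| NR6_left: "x \<in> letters \<Gamma> \<Longrightarrow> net_rel \<Gamma> [Zero, x] [Zero]"
| NR6_right: "x \<in> letters \<Gamma> \<Longrightarrow> net_rel \<Gamma> [x, Zero] [Zero]"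

definition word_eq :: "('v, 't) network_data \<Rightarrow> ('v, 't) letter list \<Rightarrow> ('v, 't) letter list \<Rightarrow> bool" where
  "word_eq \<Gamma> = pres_cong (letters \<Gamma>) (net_rel \<Gamma>)"

definition word_class :: "('v, 't) network_data \<Rightarrow> ('v, 't) letter list \<Rightarrow> ('v, 't) letter list set" where
  "word_class \<Gamma> w = {w'. word_eq \<Gamma> w w'}"

definition Q_carrier :: "('v, 't) network_data \<Rightarrow> ('v, 't) letter list set set" where
  "Q_carrier \<Gamma> = word_class \<Gamma> ` free_words (letters \<Gamma>)"

definition Q_mult :: "('v, 't) network_data \<Rightarrow>
    ('v, 't) letter list set \<Rightarrow> ('v, 't) letter list set \<Rightarrow> ('v, 't) letter list set" where
  "Q_mult \<Gamma> P P' = (\<Union>u\<in>P. \<Union>v\<in>P'. word_class \<Gamma> (u @ v))"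

lemma nz_letters_simps [simp]:
  "Rel t \<in> nz_letters \<Gamma> \<longleftrightarrow> t \<in> rels \<Gamma>"
  "Inv t \<in> nz_letters \<Gamma> \<longleftrightarrow> t \<in> rels \<Gamma>"
  "Obj A \<in> nz_letters \<Gamma> \<longleftrightarrow> A \<in> T0 \<Gamma>"
  "Zero \<notin> nz_letters \<Gamma>"
  by (auto simp: nz_letters_def)

lemma source_target_T0 [simp]:
  assumes "t \<in> rels \<Gamma>"
  shows "source \<Gamma> t \<in> T0 \<Gamma>" and "target \<Gamma> t \<in> T0 \<Gamma>"
  using assms by (simp_all add: T0_def)

lemma lsource_ltarget_T0 [simp]:
  assumes "x \<in> nz_letters \<Gamma>"
  shows "lsource \<Gamma> x \<in> T0 \<Gamma>" and "ltarget \<Gamma> x \<in> T0 \<Gamma>"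
  using assms by (cases x; simp)+

lemma net_rel_words:
  assumes "net_rel \<Gamma> u v"
  shows "u \<in> free_words (letters \<Gamma>) \<and> v \<in> free_words (letters \<Gamma>)"
  using assms by cases (simp_all add: free_words_def letters_def)

lemma word_eq_words:
  assumes "word_eq \<Gamma> u v"
  shows "u \<in> free_words (letters \<Gamma>) \<and> v \<in> free_words (letters \<Gamma>)"
  using assms unfolding word_eq_def
proof (induction rule: pres_cong.induct)
  case (base u v)
  then show ?case by (rule net_rel_words)
qed (auto simp: free_words_def)

lemma word_class_eq_iff:
  assumes "u \<in> free_words (letters \<Gamma>)"
  shows "word_class \<Gamma> u = word_class \<Gamma> v \<longleftrightarrow> word_eq \<Gamma> u v"
proof
  assume "word_class \<Gamma> u = word_class \<Gamma> v"
  moreover have "u \<in> word_class \<Gamma> u"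
    using assms by (simp add: word_class_def word_eq_def pres_cong.refl)
  ultimately have "word_eq \<Gamma> v u"
    by (simp add: word_class_def)
  then show "word_eq \<Gamma> u v"
    unfolding word_eq_def by (rule pres_cong.sym)
next
  assume uv: "word_eq \<Gamma> u v"
  have "word_eq \<Gamma> u w \<longleftrightarrow> word_eq \<Gamma> v w" for w
    using uv unfolding word_eq_def by (metis pres_cong.sym pres_cong.trans)
  then show "word_class \<Gamma> u = word_class \<Gamma> v"
    by (simp add: word_class_def)
qed

lemma Q_mult_word_class:
  assumes "u \<in> free_words (letters \<Gamma>)" "v \<in> free_words (letters \<Gamma>)"
  shows "Q_mult \<Gamma> (word_class \<Gamma> u) (word_class \<Gamma> v) = word_class \<Gamma> (u @ v)"
proof -
  have uv: "u @ v \<in> free_words (letters \<Gamma>)"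
    using assms by (auto simp: free_words_def)
  have "word_class \<Gamma> (u' @ v') = word_class \<Gamma> (u @ v)"
    if "u' \<in> word_class \<Gamma> u" "v' \<in> word_class \<Gamma> v" for u' v'
  proof -
    have "word_eq \<Gamma> (u @ v) (u' @ v')"
      using that by (simp add: word_class_def word_eq_def pres_cong.mult)
    then show ?thesis using word_class_eq_iff[OF uv] by metis
  qed
  moreover have "u \<in> word_class \<Gamma> u" "v \<in> word_class \<Gamma> v"
    using assms by (simp_all add: word_class_def word_eq_def pres_cong.refl)
  ultimately show ?thesis unfolding Q_mult_def by blast
qed

lemma semigroup_Q: "semigroup_on (Q_carrier \<Gamma>) (Q_mult \<Gamma>)"
proof -
  have app: "u @ v \<in> free_words (letters \<Gamma>)"
    if "u \<in> free_words (letters \<Gamma>)" "v \<in> free_words (letters \<Gamma>)" for u v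
    using that by (auto simp: free_words_def)
  show ?thesis
    unfolding semigroup_on_def Q_carrier_def by (auto simp: Q_mult_word_class app)
qed


section \<open>Paths\<close>

definition nonzero_path :: "('v, 't) network_data \<Rightarrow> ('v, 't) letter list \<Rightarrow> bool" where
  "nonzero_path \<Gamma> \<alpha> \<longleftrightarrow> \<alpha> \<noteq> [] \<and> set \<alpha> \<subseteq> Rel ` rels \<Gamma> \<union> Obj ` T0 \<Gamma> \<and>
     (\<forall>i. Suc i < length \<alpha> \<longrightarrow> ltarget \<Gamma> (\<alpha> ! i) \<inter> lsource \<Gamma> (\<alpha> ! Suc i) \<noteq> {})"

definition path_target :: "('v, 't) network_data \<Rightarrow> ('v, 't) letter list \<Rightarrow> 'v set" where
  "path_target \<Gamma> \<alpha> = ltarget \<Gamma> (last \<alpha>)"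

definition path_inv :: "('v, 't) letter list \<Rightarrow> ('v, 't) letter list" where
  "path_inv \<alpha> = map linv (rev \<alpha>)"

definition linear_path :: "('v, 't) network_data \<Rightarrow> ('v, 't) letter list \<Rightarrow> bool" where
  "linear_path \<Gamma> \<alpha> \<longleftrightarrow>
     (\<forall>i. Suc i < length \<alpha> \<longrightarrow> ltarget \<Gamma> (\<alpha> ! i) = lsource \<Gamma> (\<alpha> ! Suc i))"

definition reduced_path :: "('v, 't) network_data \<Rightarrow> ('v, 't) letter list \<Rightarrow> bool" where
  "reduced_path \<Gamma> \<alpha> \<longleftrightarrow>
     (\<forall>i. Suc i < length \<alpha> \<longrightarrow> \<alpha> ! i \<noteq> Obj (lsource \<Gamma> (\<alpha> ! Suc i)) \<and>
                                \<alpha> ! Suc i \<noteq> Obj (ltarget \<Gamma> (\<alpha> ! i)))"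

definition RP :: "('v, 't) network_data \<Rightarrow> ('v, 't) letter list set" where
  "RP \<Gamma> = {\<alpha>. nonzero_path \<Gamma> \<alpha> \<and> reduced_path \<Gamma> \<alpha>} \<union> {[Zero]}"

definition RLP :: "('v, 't) network_data \<Rightarrow> ('v, 't) letter list set" where
  "RLP \<Gamma> = {\<alpha>. nonzero_path \<Gamma> \<alpha> \<and> reduced_path \<Gamma> \<alpha> \<and> linear_path \<Gamma> \<alpha>}"

text \<open>The elements of \<open>T\<^sup>0\<close> as paths of length one.\<close>

definition T0_paths :: "('v, 't) network_data \<Rightarrow> ('v, 't) letter list set" where
  "T0_paths \<Gamma> = (\<lambda>A. [Obj A]) ` T0 \<Gamma>"

definition S_net :: "('v, 't) network_data \<Rightarrow> ('v, 't) letter list set set" where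
  "S_net \<Gamma> = {word_class \<Gamma> (\<alpha> @ path_inv \<beta>) | \<alpha> \<beta>.
      \<alpha> \<in> RP \<Gamma> - {[Zero]} \<and> \<beta> \<in> RLP \<Gamma> - T0_paths \<Gamma> \<and> path_target \<Gamma> \<alpha> = path_target \<Gamma> \<beta>}
    \<union> {word_class \<Gamma> [Zero]}"

definition R_net :: "('v, 't) network_data \<Rightarrow> ('v, 't) letter list set set" where
  "R_net \<Gamma> = {word_class \<Gamma> (\<alpha> @ path_inv \<beta>) | \<alpha> \<beta>.
      word_class \<Gamma> (\<alpha> @ path_inv \<beta>) \<in> S_net \<Gamma> \<and>
      \<alpha> \<in> RLP \<Gamma> - T0_paths \<Gamma> \<and> \<beta> \<in> RLP \<Gamma> - T0_paths \<Gamma> \<and> path_target \<Gamma> \<alpha> = path_target \<Gamma> \<beta>}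
    \<union> {word_class \<Gamma> [Zero]}"

end

theory Submission
  imports Defs
begin

text \<open>Put \<open>B = r(t)\<close>. As \<open>B\<close> lies in no non-singleton source or range, \<open>B\<close> is a single
vertex, and the only member of \<open>T\<^sup>0\<close> that meets \<open>B\<close> is \<open>B\<close> itself; since no relation starts at
\<open>B\<close>, a reduced path that has reached \<open>B\<close> through a relation cannot be continued. Let \<open>I\<close> consist of
\<open>0\<close> and the elements \<open>[\<alpha>\<beta>\<inverse>]\<close> with \<open>r(\<alpha>) = r(\<beta>) = B\<close>. In a non-zero product of \<open>\<alpha>\<beta>\<inverse>\<close> and
\<open>\<gamma>\<delta>\<inverse>\<close> one of \<open>\<beta>\<close> and \<open>\<gamma>\<close> is consumed by the other, and as nothing leaves \<open>B\<close>, the product again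
has its turning point in \<open>B\<close> if one of the factors has. Hence \<open>I\<close> is an ideal. The idempotent
\<open>[\<alpha>\<beta>\<inverse>]\<^sup>*\<close> is \<open>[\<beta>\<beta>\<inverse>]\<close>, so \<open>I\<close> is closed under the star and its Rees congruence is a unary
congruence. It is not the identity, because \<open>[tt\<inverse>]\<close> is identified with \<open>0\<close>, and not universal,
because \<open>[qq\<inverse>]\<close> is outside \<open>I\<close>. Both witnesses lie in \<open>R\<^sub>\<Gamma>\<close>, so the same argument applies there.

The work lies in telling elements apart in a semigroup that is given by generators and relations.
For this the letters act on pairs \<open>(\<gamma>, \<delta>)\<close>, which stand for the words
\<open>\<gamma>\<delta>\<inverse>\<close>, together with a zero: \<open>step\<close> is multiplication by a letter from the left followed by
reduction. The action satisfies the defining relations (\<open>act_word_eq\<close>), and acting on a pair does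
not change the class of the product (\<open>word_eq_act\<close>). So \<open>act\<close> is the left regular representation of
\<open>Q\<^sub>\<Gamma>\<close>, the pairs are unique normal forms for the elements of \<open>S\<^sub>\<Gamma>\<close> (\<open>nf_class_eq_iff\<close>), and every
statement about \<open>S\<^sub>\<Gamma>\<close> becomes a computation with paths. In particular the value of the star
(\<open>star_Some\<close>) rests on a cancellation law for the action of a path (\<open>act_path_cancel\<close>), and the
ideal property on \<open>ends_at_mult\<close>.\<close>

section \<open>Star operations and Rees congruences\<close>

text \<open>The identity of \<open>S\<^sup>1\<close> may be an element of \<open>S\<close> or an adjoined one; either way \<open>e\<cdot>e = e\<cdot>1\<close>
transfers to \<open>a\<close>.\<close>

lemma Lstar_absorb:
  assumes "Lstar S m a e" "e \<in> S" "m e e = e" "a \<in> S"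
  shows "m a e = a"
proof (cases "\<exists>i\<in>S. \<forall>x\<in>S. m i x = x \<and> m x i = x")
  case True
  then obtain i where i: "i \<in> S" "\<And>x. x \<in> S \<Longrightarrow> m x i = x" by blast
  have "Some e \<in> adjoin_one S m" "Some i \<in> adjoin_one S m"
    using True i(1) assms(2) unfolding adjoin_one_def by auto
  then have "m a e = m a i \<longleftrightarrow> m e e = m e i"
    using assms(1) unfolding Lstar_def by (metis mult_one.simps(2))
  then show ?thesis using assms i by simp
next
  case False
  then have "Some e \<in> adjoin_one S m" "None \<in> adjoin_one S m"
    using assms(2) unfolding adjoin_one_def by auto
  then have "m a e = a \<longleftrightarrow> m e e = e"
    using assms(1) unfolding Lstar_def by (metis mult_one.simps)
  then show ?thesis using assms by simp
qed

text \<open>Since \<open>ae = a\<close> and \<open>ee = e\<close>, a right factor \<open>1\<close> can be replaced by \<open>e\<close>. Therefore only factors from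
\<open>S\<close> have to be compared, and one of the two implications follows from \<open>ax = a(ex)\<close>.\<close>

lemma LstarI:
  assumes sg: "semigroup_on S m" and S: "a \<in> S" "e \<in> S" and e: "m e e = e" "m a e = a"
    and canc: "\<And>x y. x \<in> S \<Longrightarrow> y \<in> S \<Longrightarrow> m a x = m a y \<Longrightarrow> m e x = m e y"
  shows "Lstar S m a e"
proof -
  have assoc: "m (m b c) d = m b (m c d)" if "b \<in> S" "c \<in> S" "d \<in> S" for b c d
    using sg that by (simp add: semigroup_on_def)
  have iff: "m a x = m a y \<longleftrightarrow> m e x = m e y" if xy: "x \<in> S" "y \<in> S" for x y
  proof
    assume "m e x = m e y"
    then have "m (m a e) x = m (m a e) y" using assoc S xy by simp
    then show "m a x = m a y" using e(2) by simp
  qed (rule canc[OF xy])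
  have "\<exists>x\<in>S. mult_one m a u = m a x \<and> mult_one m e u = m e x" if "u \<in> adjoin_one S m" for u
  proof (cases u)
    case None
    then show ?thesis using e S by (intro bexI[of _ e]) auto
  next
    case (Some x)
    then have "x \<in> S" using that by (auto simp: adjoin_one_def split: if_splits)
    then show ?thesis using Some by auto
  qed
  then show ?thesis unfolding Lstar_def using iff by metis
qed

lemma Lstar_sym: "Lstar S m a b \<Longrightarrow> Lstar S m b a"
  unfolding Lstar_def by blast

lemma Lstar_trans: "Lstar S m a b \<Longrightarrow> Lstar S m b c \<Longrightarrow> Lstar S m a c"
  unfolding Lstar_def by blast

text \<open>Idempotents in the same class of the relation absorb each other from the right, so it suffices to
have uniqueness among those \<open>f\<close> with \<open>ef = e\<close> and \<open>fe = f\<close>.\<close>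

lemma star_eqI:
  assumes "e \<in> S" "m e e = e" "Lstar S m a e"
    and uniq: "\<And>f. f \<in> S \<Longrightarrow> m e f = e \<Longrightarrow> m f e = f \<Longrightarrow> f = e"
  shows "star S m a = e"
  unfolding star_def
proof (rule the_equality)
  fix f assume f: "f \<in> S \<and> m f f = f \<and> Lstar S m a f"
  then have ef: "Lstar S m e f" by (intro Lstar_trans[OF Lstar_sym[OF assms(3)]]) simp
  show "f = e"
  proof (rule uniq)
    show "m e f = e" using Lstar_absorb[OF ef] f assms(1) by blast
    show "m f e = f" using Lstar_absorb[OF Lstar_sym[OF ef]] f assms(1,2) by blast
  qed (use f in blast)
qed (use assms in blast)

lemma Rees_congruence:
  assumes sg: "semigroup_on S m" and "I \<subseteq> S"
    and ideal: "\<And>a c. a \<in> I \<Longrightarrow> c \<in> S \<Longrightarrow> m c a \<in> I \<and> m a c \<in> I"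
  shows "sg_congruence S m (Id_on S \<union> I \<times> I)"
proof -
  have "equiv S (Id_on S \<union> I \<times> I)"
    using assms(2) by (intro equivI) (auto simp: refl_on_def sym_def trans_def)
  then show ?thesis
    using sg ideal unfolding sg_congruence_def semigroup_on_def by blast
qed

lemma not_congruence_freeI:
  "sg_congruence S m \<rho> \<Longrightarrow> \<rho> \<noteq> Id_on S \<Longrightarrow> \<rho> \<noteq> S \<times> S \<Longrightarrow> \<not> congruence_free S m"
  unfolding congruence_free_def by blast

lemma not_star_congruence_freeI:
  "unary_sg_congruence S m (star S m) \<rho> \<Longrightarrow> \<rho> \<noteq> Id_on S \<Longrightarrow> \<rho> \<noteq> S \<times> S \<Longrightarrow>
    \<not> star_congruence_free S m"
  unfolding star_congruence_free_def by blast

section \<open>Normal forms and the action of the letters\<close>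

definition reduced_pair :: "('v, 't) network_data \<Rightarrow> ('v, 't) letter \<Rightarrow> ('v, 't) letter \<Rightarrow> bool" where
  "reduced_pair \<Gamma> x y \<longleftrightarrow> ltarget \<Gamma> x \<inter> lsource \<Gamma> y \<noteq> {} \<and> x \<noteq> Obj (lsource \<Gamma> y) \<and> y \<noteq> Obj (ltarget \<Gamma> x)"

definition fwd_letters :: "('v, 't) network_data \<Rightarrow> ('v, 't) letter set" where
  "fwd_letters \<Gamma> = Rel ` rels \<Gamma> \<union> Obj ` T0 \<Gamma>"

definition rpath :: "('v, 't) network_data \<Rightarrow> ('v, 't) letter list \<Rightarrow> bool" where
  "rpath \<Gamma> \<gamma> \<longleftrightarrow> \<gamma> \<noteq> [] \<and> set \<gamma> \<subseteq> fwd_letters \<Gamma> \<and> successively (reduced_pair \<Gamma>) \<gamma>"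

text \<open>Linear paths without letters from \<open>T\<^sup>0\<close>. The non-empty ones and the single members of \<open>T\<^sup>0\<close> are all
the reduced linear paths (see \<open>linked_cases\<close> below). The empty list is included for induction and
as the second component of the normal form of a path.\<close>

definition rel_path :: "('v, 't) network_data \<Rightarrow> 't list \<Rightarrow> bool" where
  "rel_path \<Gamma> \<delta> \<longleftrightarrow> set \<delta> \<subseteq> rels \<Gamma> \<and> successively (\<lambda>t u. target \<Gamma> t = source \<Gamma> u) \<delta>"

text \<open>\<open>Some (\<gamma>, \<delta>)\<close> stands for the word \<open>\<gamma>\<delta>\<inverse>\<close> and \<open>None\<close> for \<open>0\<close>. An empty \<open>\<delta>\<close> encodes an element of
\<open>Q\<^sub>\<Gamma>\<close> that is represented by a path alone.\<close>

type_synonym ('v, 't) nform = "(('v, 't) letter list \<times> 't list) option"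

fun normal :: "('v, 't) network_data \<Rightarrow> ('v, 't) nform \<Rightarrow> bool" where
  "normal \<Gamma> None = True"
| "normal \<Gamma> (Some (\<gamma>, \<delta>)) = (rpath \<Gamma> \<gamma> \<and> rel_path \<Gamma> \<delta> \<and>
     (\<delta> \<noteq> [] \<longrightarrow> path_target \<Gamma> \<gamma> = target \<Gamma> (last \<delta>)))"

fun nf_word :: "('v, 't) nform \<Rightarrow> ('v, 't) letter list" where
  "nf_word None = [Zero]"
| "nf_word (Some (\<gamma>, \<delta>)) = \<gamma> @ map Inv (rev \<delta>)"

text \<open>The reduced form of \<open>x\<gamma>\<delta>\<inverse>\<close> for \<open>x\<close> in \<open>T \<union> T\<^sup>0\<close>: as \<open>\<gamma>\<close> is already reduced, at most one letter is
absorbed, namely the first letter of \<open>\<gamma>\<close> by \<open>x\<close> or \<open>x\<close> by that letter.\<close>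

definition prepend :: "('v, 't) network_data \<Rightarrow> ('v, 't) letter \<Rightarrow> ('v, 't) letter list \<Rightarrow>
    't list \<Rightarrow> ('v, 't) nform" where
  "prepend \<Gamma> x \<gamma> \<delta> = (if ltarget \<Gamma> x \<inter> lsource \<Gamma> (hd \<gamma>) = {} then None
     else if hd \<gamma> = Obj (ltarget \<Gamma> x) then Some (x # tl \<gamma>, \<delta>)
     else if x = Obj (lsource \<Gamma> (hd \<gamma>)) then Some (\<gamma>, \<delta>)
     else Some (x # \<gamma>, \<delta>))"

text \<open>For an inverse letter there are two ways to avoid \<open>0\<close>. If \<open>\<gamma>\<close> starts with \<open>t\<close>, then \<open>t\<inverse>t = r(t)\<close>,
which has to be merged with the rest of \<open>\<gamma>\<close>, if there is any. If \<open>\<gamma>\<close> is just \<open>s(t)\<close>, then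
\<open>t\<inverse>s(t)\<delta>\<inverse> = r(t)(\<delta>t)\<inverse>\<close>, and this is the only case in which \<open>\<delta>\<close> changes.\<close>

fun step :: "('v, 't) network_data \<Rightarrow> ('v, 't) letter \<Rightarrow> ('v, 't) nform \<Rightarrow> ('v, 't) nform" where
  "step \<Gamma> x None = None"
| "step \<Gamma> Zero (Some p) = None"
| "step \<Gamma> (Rel t) (Some (\<gamma>, \<delta>)) = prepend \<Gamma> (Rel t) \<gamma> \<delta>"
| "step \<Gamma> (Obj A) (Some (\<gamma>, \<delta>)) = prepend \<Gamma> (Obj A) \<gamma> \<delta>"
| "step \<Gamma> (Inv t) (Some (\<gamma>, \<delta>)) =
    (if \<gamma> = [Rel t] then Some ([Obj (target \<Gamma> t)], \<delta>)
     else if hd \<gamma> = Rel t then prepend \<Gamma> (Obj (target \<Gamma> t)) (tl \<gamma>) \<delta>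
     else if \<gamma> = [Obj (source \<Gamma> t)] then Some ([Obj (target \<Gamma> t)], \<delta> @ [t])
     else None)"

abbreviation act :: "('v, 't) network_data \<Rightarrow> ('v, 't) letter list \<Rightarrow> ('v, 't) nform \<Rightarrow> ('v, 't) nform" where
  "act \<Gamma> w \<equiv> foldr (step \<Gamma>) w"

lemma act_None [simp]: "act \<Gamma> w None = None"
  by (induction w) auto

lemma step_Zero [simp]: "step \<Gamma> Zero p = None"
  by (cases p) auto

lemma fwd_step:
  assumes "x \<in> fwd_letters \<Gamma>" shows "step \<Gamma> x (Some (\<gamma>, \<delta>)) = prepend \<Gamma> x \<gamma> \<delta>"
  using assms by (auto simp: fwd_letters_def)

lemma fwd_nz: "x \<in> fwd_letters \<Gamma> \<Longrightarrow> x \<in> nz_letters \<Gamma>"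
  by (auto simp: fwd_letters_def)

lemma rpath_Cons:
  "rpath \<Gamma> (x # \<gamma>) \<longleftrightarrow> x \<in> fwd_letters \<Gamma> \<and> (\<gamma> = [] \<or> (reduced_pair \<Gamma> x (hd \<gamma>) \<and> rpath \<Gamma> \<gamma>))"
  by (auto simp: rpath_def successively_Cons)

lemma rel_path_snoc:
  "rel_path \<Gamma> (\<delta> @ [t]) \<longleftrightarrow> rel_path \<Gamma> \<delta> \<and> t \<in> rels \<Gamma> \<and> (\<delta> \<noteq> [] \<longrightarrow> target \<Gamma> (last \<delta>) = source \<Gamma> t)"
  by (auto simp: rel_path_def successively_append_iff)

lemma rel_path_Cons:
  "rel_path \<Gamma> (t # \<delta>) \<longleftrightarrow> t \<in> rels \<Gamma> \<and> (\<delta> = [] \<or> (target \<Gamma> t = source \<Gamma> (hd \<delta>) \<and> rel_path \<Gamma> \<delta>))"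
  by (auto simp: rel_path_def successively_Cons)

section \<open>The action respects the defining relations\<close>

context
  fixes \<Gamma> :: "('v, 't) network_data"
  assumes net: "network \<Gamma>"
begin

lemma T0_nonempty: "A \<in> T0 \<Gamma> \<Longrightarrow> A \<noteq> {}"
  using net by (auto simp: network_def T0_def vertex_sets_def)

lemma prepend_props:
  assumes "x \<in> fwd_letters \<Gamma>" "rpath \<Gamma> \<gamma>" "prepend \<Gamma> x \<gamma> \<delta> = Some (\<gamma>', \<delta>')"
  shows "rpath \<Gamma> \<gamma>' \<and> \<delta>' = \<delta> \<and> path_target \<Gamma> \<gamma>' = path_target \<Gamma> \<gamma> \<and> lsource \<Gamma> (hd \<gamma>') = lsource \<Gamma> x"
proof -
  obtain y ys where g: "\<gamma> = y # ys" using assms(2) by (cases \<gamma>) (auto simp: rpath_def)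
  have meet: "ltarget \<Gamma> x \<inter> lsource \<Gamma> y \<noteq> {}"
    using assms(3) by (auto simp: prepend_def g)
  consider "y = Obj (ltarget \<Gamma> x)" "\<gamma>' = x # ys" "\<delta>' = \<delta>"
    | "x = Obj (lsource \<Gamma> y)" "\<gamma>' = \<gamma>" "\<delta>' = \<delta>"
    | "y \<noteq> Obj (ltarget \<Gamma> x)" "x \<noteq> Obj (lsource \<Gamma> y)" "\<gamma>' = x # \<gamma>" "\<delta>' = \<delta>"
    using assms(3) meet by (simp add: prepend_def g split: if_splits)
  then show ?thesis
  proof cases
    case 1
    have "reduced_pair \<Gamma> x (hd ys)" if "ys \<noteq> []"
      using that assms(1,2) 1(1) by (auto simp: g rpath_Cons reduced_pair_def fwd_letters_def)
    then show ?thesis using 1 assms(1,2) by (auto simp: g rpath_Cons path_target_def)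
  next
    case 2
    then show ?thesis using assms(2) by (simp add: g)
  next
    case 3
    then show ?thesis using assms(1,2) meet
      by (simp add: g rpath_Cons path_target_def reduced_pair_def)
  qed
qed

text \<open>The relation \<open>s(t)t = t\<close>, on normal forms.\<close>

lemma prepend_absorb:
  assumes "A \<in> T0 \<Gamma>" "rpath \<Gamma> \<gamma>" "lsource \<Gamma> (hd \<gamma>) = A"
  shows "prepend \<Gamma> (Obj A) \<gamma> \<delta> = Some (\<gamma>, \<delta>)"
proof -
  obtain y ys where g: "\<gamma> = y # ys" using assms(2) by (cases \<gamma>) (auto simp: rpath_def)
  have "A \<noteq> {}" using assms(1) by (rule T0_nonempty)
  then show ?thesis using assms(3) unfolding g prepend_def by simp
qed

text \<open>The range of the first component is the invariant that later defines the ideal. It can change only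
when \<open>\<delta>\<close> grows, and then \<open>\<gamma>\<close> is a single letter that is the source of some relation.\<close>

lemma step_props:
  assumes "x \<in> nz_letters \<Gamma>" "normal \<Gamma> (Some (\<gamma>, \<delta>))" "step \<Gamma> x (Some (\<gamma>, \<delta>)) = Some (\<gamma>', \<delta>')"
  shows "normal \<Gamma> (Some (\<gamma>', \<delta>')) \<and> lsource \<Gamma> (hd \<gamma>') = lsource \<Gamma> x \<and>
    (\<delta>' = \<delta> \<and> path_target \<Gamma> \<gamma>' = path_target \<Gamma> \<gamma> \<or>
     (\<exists>t\<in>rels \<Gamma>. x = Inv t \<and> \<gamma> = [Obj (source \<Gamma> t)] \<and> \<delta>' = \<delta> @ [t]))"
proof (cases "x \<in> fwd_letters \<Gamma>")
  case True
  then have "prepend \<Gamma> x \<gamma> \<delta> = Some (\<gamma>', \<delta>')" using assms(3) by (simp add: fwd_step)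
  then show ?thesis using prepend_props[OF True, of \<gamma> \<delta> \<gamma>' \<delta>'] assms(2) by simp
next
  case False
  then obtain t where x: "x = Inv t" and t: "t \<in> rels \<Gamma>"
    using assms(1) by (auto simp: nz_letters_def fwd_letters_def)
  have O: "Obj (target \<Gamma> t) \<in> fwd_letters \<Gamma>" using t by (auto simp: fwd_letters_def)
  have rp: "rpath \<Gamma> \<gamma>" using assms(2) by simp
  consider "\<gamma> = [Rel t]" | ys where "\<gamma> = Rel t # ys" "ys \<noteq> []" | "\<gamma> = [Obj (source \<Gamma> t)]"
  proof (cases "hd \<gamma> = Rel t")
    case True
    then have "\<gamma> = Rel t # tl \<gamma>" using rp by (cases \<gamma>) (simp_all add: rpath_def)
    then show ?thesis using that(1,2) by metis
  next
    case False
    then show ?thesis using assms(3) that(1,3) by (simp add: x split: if_splits)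
  qed
  then show ?thesis
  proof cases
    case 2
    then have "rpath \<Gamma> ys" using rp by (auto simp: rpath_Cons)
    moreover have "prepend \<Gamma> (Obj (target \<Gamma> t)) ys \<delta> = Some (\<gamma>', \<delta>')"
      using assms(3) 2 by (simp add: x)
    ultimately have "rpath \<Gamma> \<gamma>' \<and> \<delta>' = \<delta> \<and> path_target \<Gamma> \<gamma>' = path_target \<Gamma> ys \<and>
        lsource \<Gamma> (hd \<gamma>') = target \<Gamma> t"
      using prepend_props[OF O, of ys \<delta> \<gamma>' \<delta>'] by simp
    then show ?thesis using assms(2) 2 by (simp add: x path_target_def)
  next
    case 1
    then have "\<gamma>' = [Obj (target \<Gamma> t)]" "\<delta>' = \<delta>" using assms(3) by (simp_all add: x)
    then show ?thesis using 1 assms(2) O by (simp add: x path_target_def rpath_def)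
  next
    case 3
    then have "\<gamma>' = [Obj (target \<Gamma> t)]" "\<delta>' = \<delta> @ [t]" using assms(3) by (simp_all add: x)
    then show ?thesis using 3 assms(2) O t by (simp add: x path_target_def rpath_def rel_path_snoc)
  qed
qed

lemma normal_step:
  assumes "x \<in> letters \<Gamma>" "normal \<Gamma> p" shows "normal \<Gamma> (step \<Gamma> x p)"
proof (cases "step \<Gamma> x p")
  case (Some q)
  obtain \<gamma> \<delta> where p: "p = Some (\<gamma>, \<delta>)"
  proof (cases p)
    case (Some r)
    then show ?thesis using that by (cases r) simp
  qed (use Some in simp)
  obtain \<gamma>' \<delta>' where q: "q = (\<gamma>', \<delta>')" by (cases q)
  have "x \<noteq> Zero" using Some p by auto
  then have "x \<in> nz_letters \<Gamma>" using assms(1) by (simp add: letters_def)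
  from step_props[OF this assms(2)[unfolded p] Some[unfolded p q]] show ?thesis
    by (simp add: Some q)
qed simp

lemma normal_act:
  "set w \<subseteq> letters \<Gamma> \<Longrightarrow> normal \<Gamma> p \<Longrightarrow> normal \<Gamma> (act \<Gamma> w p)"
  by (induction w) (auto simp: normal_step)

text \<open>Every non-zero value of \<open>step \<Gamma> x\<close> has source \<open>s(x)\<close>, and members of \<open>T\<^sup>0\<close> are non-empty. This settles
the relations \<open>s(t)t = t\<close>, \<open>t\<^sub>1t\<^sub>2 = 0\<close> for disjoint range and source, and \<open>t\<inverse>A = 0\<close>; the others follow by comparing the cases in the
definition of the action on a reduced path.\<close>

lemma step_net_rel:
  assumes "net_rel \<Gamma> u v" "normal \<Gamma> p"
  shows "act \<Gamma> u p = act \<Gamma> v p"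
proof (cases p)
  case (Some pp)
  then obtain \<gamma> \<delta> where p: "p = Some (\<gamma>, \<delta>)" by (cases pp) auto
  have rp: "rpath \<Gamma> \<gamma>" using assms(2) p by auto
  then obtain y ys where g: "\<gamma> = y # ys" by (cases \<gamma>) (auto simp: rpath_def)
  have src: "lsource \<Gamma> (hd \<gamma>') = lsource \<Gamma> x \<and> rpath \<Gamma> \<gamma>'"
    if "x \<in> nz_letters \<Gamma>" "step \<Gamma> x p = Some (\<gamma>', \<delta>')" for x \<gamma>' \<delta>'
    using step_props[OF that(1) assms(2)[unfolded p] that(2)[unfolded p]] by auto
  from assms(1) show ?thesis
  proof cases
    case (NR1_source x)
    show ?thesis
    proof (cases "step \<Gamma> x p")
      case (Some q)
      then obtain \<gamma>' \<delta>' where q: "step \<Gamma> x p = Some (\<gamma>', \<delta>')" by (cases q) auto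
      with src[OF NR1_source(3) q] prepend_absorb[of _ \<gamma>' \<delta>'] NR1_source show ?thesis by auto
    qed (use NR1_source in auto)
  next
    case (NR1_target x)
    show ?thesis
    proof (cases "x \<in> fwd_letters \<Gamma>")
      case True
      then show ?thesis using NR1_target p g
        by (auto simp: fwd_step prepend_def)
    next
      case False
      then obtain t where x: "x = Inv t" and t: "t \<in> rels \<Gamma>"
        using NR1_target by (auto simp: nz_letters_def fwd_letters_def)
      then show ?thesis using NR1_target p g T0_nonempty[of "source \<Gamma> t"]
        by (auto simp: prepend_def)
    qed
  next
    case (NR2 x y)
    show ?thesis
    proof (cases "step \<Gamma> y p")
      case (Some q)
      then obtain \<gamma>' \<delta>' where q: "step \<Gamma> y p = Some (\<gamma>', \<delta>')" by (cases q) auto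
      have s: "lsource \<Gamma> (hd \<gamma>') = lsource \<Gamma> y" "rpath \<Gamma> \<gamma>'" using src[OF NR2(4) q] by auto
      have ne: "lsource \<Gamma> y \<noteq> {}" using NR2 T0_nonempty by auto
      have "step \<Gamma> x (Some (\<gamma>', \<delta>')) = None"
        using NR2 s ne by (cases x) (auto simp: prepend_def)
      then show ?thesis using NR2 q p by auto
    qed (use NR2 p in auto)
  next
    case (NR3 t u)
    then show ?thesis using p by (auto simp: prepend_def)
  next
    case (NR4 t)
    then show ?thesis using p g rp T0_nonempty[of "target \<Gamma> t"]
      by (cases ys) (auto simp: prepend_def rpath_Cons reduced_pair_def)
  next
    case (NR5 t A)
    show ?thesis
    proof (cases "step \<Gamma> (Obj A) p")
      case (Some q)
      then obtain \<gamma>' \<delta>' where q: "step \<Gamma> (Obj A) p = Some (\<gamma>', \<delta>')" by (cases q) auto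
      have s: "lsource \<Gamma> (hd \<gamma>') = A" using src[OF _ q] NR5 by auto
      then show ?thesis using NR5 q p by auto
    qed (use NR5 p in auto)
  next
    case (NR6_right x)
    then show ?thesis using p by (cases x) auto
  qed (use p in auto)
qed simp

lemma act_word_eq:
  assumes "word_eq \<Gamma> u v" "normal \<Gamma> p"
  shows "act \<Gamma> u p = act \<Gamma> v p"
  using assms unfolding word_eq_def
proof (induction arbitrary: p rule: pres_cong.induct)
  case (base u v)
  then show ?case by (rule step_net_rel)
next
  case (mult u u' v v')
  have "set v \<subseteq> letters \<Gamma>"
    using word_eq_words[of \<Gamma> v v'] mult.hyps by (simp add: word_eq_def free_words_def)
  then show ?case using mult.IH mult.prems normal_act[of v p] by simp
qed auto

end

section \<open>Words reduce to normal forms\<close>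

context
  fixes \<Gamma> :: "('v, 't) network_data"
  assumes net: "network \<Gamma>"
begin

lemma word_eq_append:
  assumes "word_eq \<Gamma> u u'" "set v \<subseteq> letters \<Gamma>"
  shows "word_eq \<Gamma> (u @ v) (u' @ v)"
proof (cases "v = []")
  case False
  then have "word_eq \<Gamma> v v"
    using assms(2) by (simp add: word_eq_def pres_cong.refl free_words_def)
  then show ?thesis using assms(1) unfolding word_eq_def by (intro pres_cong.mult)
qed (use assms in simp)

lemma word_eq_Cons:
  assumes "word_eq \<Gamma> u u'" "x \<in> letters \<Gamma>"
  shows "word_eq \<Gamma> (x # u) (x # u')"
proof -
  have "pres_cong (letters \<Gamma>) (net_rel \<Gamma>) [x] [x]"
    using assms(2) by (simp add: pres_cong.refl free_words_def)
  from pres_cong.mult[OF this assms(1)[unfolded word_eq_def]] show ?thesis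
    by (simp add: word_eq_def)
qed

lemma word_eq_trans [trans]: "word_eq \<Gamma> u v \<Longrightarrow> word_eq \<Gamma> v w \<Longrightarrow> word_eq \<Gamma> u w"
  unfolding word_eq_def by (rule pres_cong.trans)

lemma word_eq_net_rel:
  assumes "net_rel \<Gamma> u u'" "set v \<subseteq> letters \<Gamma>"
  shows "word_eq \<Gamma> (u @ v) (u' @ v)"
  using assms by (intro word_eq_append) (simp_all add: word_eq_def pres_cong.base)

lemma word_eq_Zero:
  assumes "set v \<subseteq> letters \<Gamma>"
  shows "word_eq \<Gamma> (Zero # v) [Zero]"
  using assms
proof (induction v)
  case Nil
  then show ?case by (simp add: word_eq_def pres_cong.refl free_words_def letters_def)
next
  case (Cons x v)
  have "word_eq \<Gamma> ([Zero, x] @ v) ([Zero] @ v)"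
    using Cons by (intro word_eq_net_rel net_rel.intros) auto
  also have "word_eq \<Gamma> ([Zero] @ v) [Zero]" using Cons by simp
  finally show ?case by simp
qed

lemma word_eq_net_rel_Zero:
  assumes "net_rel \<Gamma> u [Zero]" "set v \<subseteq> letters \<Gamma>"
  shows "word_eq \<Gamma> (u @ v) [Zero]"
  using word_eq_trans[OF word_eq_net_rel[OF assms]] word_eq_Zero[OF assms(2)] by simp

text \<open>Each case of \<open>prepend\<close> that shortens the word applies one defining relation to its first two letters.\<close>

lemma word_eq_prepend:
  assumes "x \<in> fwd_letters \<Gamma>" "rpath \<Gamma> \<gamma>" "set \<delta> \<subseteq> rels \<Gamma>"
  shows "word_eq \<Gamma> (x # \<gamma> @ map Inv (rev \<delta>)) (nf_word (prepend \<Gamma> x \<gamma> \<delta>))"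
proof -
  obtain y ys where g: "\<gamma> = y # ys" using assms(2) by (cases \<gamma>) (auto simp: rpath_def)
  let ?v = "ys @ map Inv (rev \<delta>)"
  have xy: "x \<in> nz_letters \<Gamma>" "y \<in> nz_letters \<Gamma>" and v: "set ?v \<subseteq> letters \<Gamma>"
    using assms by (auto simp: g rpath_def fwd_letters_def letters_def)
  consider "ltarget \<Gamma> x \<inter> lsource \<Gamma> y = {}"
    | "ltarget \<Gamma> x \<inter> lsource \<Gamma> y \<noteq> {}" "y = Obj (ltarget \<Gamma> x)"
    | "ltarget \<Gamma> x \<inter> lsource \<Gamma> y \<noteq> {}" "y \<noteq> Obj (ltarget \<Gamma> x)" "x = Obj (lsource \<Gamma> y)"
    | "ltarget \<Gamma> x \<inter> lsource \<Gamma> y \<noteq> {}" "y \<noteq> Obj (ltarget \<Gamma> x)" "x \<noteq> Obj (lsource \<Gamma> y)"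
    by blast
  then show ?thesis
  proof cases
    case 1
    then show ?thesis using word_eq_net_rel_Zero[OF NR2[OF xy 1] v] by (simp add: g prepend_def)
  next
    case 2
    then show ?thesis using word_eq_net_rel[OF NR1_target[OF xy(1)] v] by (simp add: g prepend_def)
  next
    case 3
    then show ?thesis using word_eq_net_rel[OF NR1_source[OF xy(2)] v] by (simp add: g prepend_def)
  next
    case 4
    then show ?thesis using xy v
      by (simp add: g prepend_def word_eq_def pres_cong.refl free_words_def letters_def)
  qed
qed

text \<open>The delicate case is \<open>t\<inverse>\<gamma>\<close> with \<open>\<gamma>\<close> starting with \<open>s(t)\<close>: the letter \<open>s(t)\<close> is absorbed by \<open>t\<inverse>\<close>,
and if \<open>\<gamma>\<close> has a second letter, then reducedness of \<open>\<gamma>\<close> forces its source to differ from \<open>s(t)\<close>,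
so that the product is \<open>0\<close>.\<close>

lemma word_eq_step:
  assumes "x \<in> letters \<Gamma>" "normal \<Gamma> p"
  shows "word_eq \<Gamma> (x # nf_word p) (nf_word (step \<Gamma> x p))"
proof (cases p)
  case None
  have "word_eq \<Gamma> ([x, Zero] @ []) [Zero]"
    using assms by (intro word_eq_net_rel_Zero net_rel.intros) auto
  then show ?thesis using None by simp
next
  case (Some pp)
  then obtain \<gamma> \<delta> where p: "p = Some (\<gamma>, \<delta>)" by (cases pp) auto
  have rp: "rpath \<Gamma> \<gamma>" and ch: "rel_path \<Gamma> \<delta>" using assms(2) p by auto
  then obtain y ys where g: "\<gamma> = y # ys" by (cases \<gamma>) (auto simp: rpath_def)
  let ?i = "map Inv (rev \<delta>)"
  have v: "set (ys @ ?i) \<subseteq> letters \<Gamma>" "set \<delta> \<subseteq> rels \<Gamma>"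
    using rp ch by (auto simp: g rpath_def rel_path_def fwd_letters_def letters_def)
  have y: "y \<in> letters \<Gamma>" using rp by (auto simp: g rpath_def letters_def fwd_letters_def)
  consider "x = Zero" | "x \<in> fwd_letters \<Gamma>" | t where "x = Inv t" "t \<in> rels \<Gamma>"
    using assms(1) by (auto simp: letters_def nz_letters_def fwd_letters_def)
  then show ?thesis
  proof cases
    case 1
    then show ?thesis using word_eq_Zero[of "\<gamma> @ ?i"] v y by (simp add: p g)
  next
    case 2
    then show ?thesis using word_eq_prepend[OF 2 rp v(2)] by (simp add: p fwd_step)
  next
    case 3
    have O: "Obj (target \<Gamma> t) \<in> fwd_letters \<Gamma>" using 3 by (simp add: fwd_letters_def)
    consider "y = Rel t" | u where "y = Rel u" "u \<in> rels \<Gamma>" "t \<noteq> u"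
      | A where "y = Obj A" "A \<in> T0 \<Gamma>" "source \<Gamma> t \<noteq> A"
      | "y = Obj (source \<Gamma> t)"
      using rp by (auto simp: g rpath_Cons fwd_letters_def)
    then show ?thesis
    proof cases
      case 1
      have e: "word_eq \<Gamma> (x # nf_word p) (Obj (target \<Gamma> t) # ys @ ?i)"
        using word_eq_net_rel[OF NR4 v(1), of t] 3 1 by (simp add: p g)
      show ?thesis
      proof (cases "ys = []")
        case True
        then show ?thesis using e by (simp add: p g 1 3)
      next
        case False
        then have "rpath \<Gamma> ys" using rp by (simp add: g rpath_Cons)
        from word_eq_trans[OF e word_eq_prepend[OF O this v(2)]] show ?thesis
          using False by (simp add: p g 1 3)
      qed
    next
      case (2 u)
      then show ?thesis using word_eq_net_rel_Zero[OF NR3[OF 3(2) 2(2,3)] v(1)] 3 by (simp add: p g)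
    next
      case (3 A)
      then show ?thesis using word_eq_net_rel_Zero[OF NR5 v(1), of t A] \<open>x = Inv t\<close> \<open>t \<in> rels \<Gamma>\<close>
        by (simp add: p g)
    next
      case 4
      have e: "word_eq \<Gamma> (x # nf_word p) (Inv t # ys @ ?i)"
        using word_eq_net_rel[OF NR1_target v(1), of "Inv t"] 3 4 by (simp add: p g)
      show ?thesis
      proof (cases ys)
        case Nil
        have "word_eq \<Gamma> (Obj (target \<Gamma> t) # Inv t # ?i) (Inv t # ?i)"
          using word_eq_net_rel[OF NR1_source, of "Inv t" ?i] v 3 by simp
        then have "word_eq \<Gamma> (Inv t # ?i) (Obj (target \<Gamma> t) # Inv t # ?i)"
          unfolding word_eq_def by (rule pres_cong.sym)
        from word_eq_trans[OF e[unfolded Nil append_Nil] this] show ?thesis by (simp add: p g Nil 3 4)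
      next
        case (Cons z zs)
        have z: "z \<in> fwd_letters \<Gamma>" "lsource \<Gamma> z \<noteq> source \<Gamma> t"
          using rp by (auto simp: g Cons 4 rpath_Cons reduced_pair_def)
        have "net_rel \<Gamma> [Inv t, z] [Zero]"
          using z 3 by (auto simp: fwd_letters_def intro: net_rel.intros)
        from word_eq_net_rel_Zero[OF this, of "zs @ ?i"] v
        have "word_eq \<Gamma> (Inv t # ys @ ?i) [Zero]" by (simp add: Cons)
        from word_eq_trans[OF e this] show ?thesis by (simp add: p g Cons 3 4)
      qed
    qed
  qed
qed

lemma nf_word_free: "normal \<Gamma> p \<Longrightarrow> nf_word p \<in> free_words (letters \<Gamma>)"
  by (cases "(\<Gamma>, p)" rule: normal.cases)
     (auto simp: free_words_def letters_def rpath_def rel_path_def fwd_letters_def)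

lemma word_eq_act:
  assumes "set w \<subseteq> letters \<Gamma>" "normal \<Gamma> p"
  shows "word_eq \<Gamma> (w @ nf_word p) (nf_word (act \<Gamma> w p))"
  using assms(1)
proof (induction w)
  case Nil
  then show ?case using nf_word_free[OF assms(2)] by (simp add: word_eq_def pres_cong.refl)
next
  case (Cons x w)
  then have n: "normal \<Gamma> (act \<Gamma> w p)" using normal_act[OF net _ assms(2)] by simp
  have "word_eq \<Gamma> (x # w @ nf_word p) (x # nf_word (act \<Gamma> w p))"
    using Cons by (intro word_eq_Cons) auto
  also have "word_eq \<Gamma> \<dots> (nf_word (step \<Gamma> x (act \<Gamma> w p)))"
    using Cons n by (intro word_eq_step) auto
  finally show ?case by simp
qed

end

section \<open>Multiplication and uniqueness of normal forms\<close>

definition nf_class :: "('v, 't) network_data \<Rightarrow> ('v, 't) nform \<Rightarrow> ('v, 't) letter list set" where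
  "nf_class \<Gamma> p = word_class \<Gamma> (nf_word p)"

text \<open>The normal forms of elements of \<open>S\<^sub>\<Gamma>\<close> (see \<open>S_net_nf_class\<close>).\<close>

fun proper :: "('v, 't) network_data \<Rightarrow> ('v, 't) nform \<Rightarrow> bool" where
  "proper \<Gamma> None = True"
| "proper \<Gamma> (Some (\<gamma>, \<delta>)) = (normal \<Gamma> (Some (\<gamma>, \<delta>)) \<and> \<delta> \<noteq> [])"

lemma proper_normal: "proper \<Gamma> p \<Longrightarrow> normal \<Gamma> p"
  by (cases "(\<Gamma>, p)" rule: proper.cases) auto

lemma nform_cases:
  obtains "p = None" | \<gamma> \<delta> where "p = Some (\<gamma>, \<delta>)"
  by (cases p) auto

context
  fixes \<Gamma> :: "('v, 't) network_data"
  assumes net: "network \<Gamma>"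
begin

lemma nf_word_letters: "normal \<Gamma> p \<Longrightarrow> set (nf_word p) \<subseteq> letters \<Gamma>"
  using nf_word_free[OF net] by (auto simp: free_words_def)

lemma Q_mult_nf_class:
  assumes "normal \<Gamma> p" "normal \<Gamma> q"
  shows "Q_mult \<Gamma> (nf_class \<Gamma> p) (nf_class \<Gamma> q) = nf_class \<Gamma> (act \<Gamma> (nf_word p) q)"
proof -
  have f: "nf_word p \<in> free_words (letters \<Gamma>)" "nf_word q \<in> free_words (letters \<Gamma>)"
    using assms nf_word_free[OF net] by auto
  then have "nf_word p @ nf_word q \<in> free_words (letters \<Gamma>)" by (auto simp: free_words_def)
  then have "word_class \<Gamma> (nf_word p @ nf_word q) = word_class \<Gamma> (nf_word (act \<Gamma> (nf_word p) q))"
    using word_eq_act[OF net nf_word_letters[OF assms(1)] assms(2)] by (simp add: word_class_eq_iff)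
  then show ?thesis using f by (simp add: nf_class_def Q_mult_word_class)
qed

text \<open>The action never shortens \<open>\<delta>\<close>; in other words, \<open>S\<^sub>\<Gamma>\<close> is a left ideal of \<open>Q\<^sub>\<Gamma>\<close>.\<close>

lemma proper_step:
  assumes "x \<in> letters \<Gamma>" "proper \<Gamma> p"
  shows "proper \<Gamma> (step \<Gamma> x p)"
proof (cases "step \<Gamma> x p" rule: nform_cases)
  case (2 \<gamma>' \<delta>')
  obtain \<gamma> \<delta> where p: "p = Some (\<gamma>, \<delta>)" using 2 by (cases p rule: nform_cases) auto
  have "x \<noteq> Zero" using 2 p by auto
  then have "x \<in> nz_letters \<Gamma>" using assms(1) by (simp add: letters_def)
  from step_props[OF net this proper_normal[OF assms(2), unfolded p] 2[unfolded p]] assms(2)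
  have "proper \<Gamma> (Some (\<gamma>', \<delta>'))" unfolding p by auto
  then show ?thesis unfolding 2 .
qed simp

lemma proper_act: "set w \<subseteq> letters \<Gamma> \<Longrightarrow> proper \<Gamma> p \<Longrightarrow> proper \<Gamma> (act \<Gamma> w p)"
  by (induction w) (auto simp: proper_step)

text \<open>If nothing can be absorbed, a path acts by concatenation.\<close>

lemma act_path_append:
  assumes "rpath \<Gamma> (xs @ w)" "w \<noteq> []"
  shows "act \<Gamma> xs (Some (w, \<delta>)) = Some (xs @ w, \<delta>)"
  using assms
proof (induction xs)
  case (Cons x xs)
  then have x: "x \<in> fwd_letters \<Gamma>" "reduced_pair \<Gamma> x (hd (xs @ w))" "rpath \<Gamma> (xs @ w)"
    by (auto simp: rpath_Cons)
  then show ?case using Cons by (simp add: fwd_step prepend_def reduced_pair_def)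
qed simp

lemma act_inverse_obj:
  assumes "rel_path \<Gamma> \<delta>" "\<delta> \<noteq> []"
  shows "act \<Gamma> (map Inv (rev \<delta>)) (Some ([Obj A], \<delta>0)) =
    (if A = source \<Gamma> (hd \<delta>) then Some ([Obj (target \<Gamma> (last \<delta>))], \<delta>0 @ \<delta>) else None)"
  using assms
proof (induction \<delta> arbitrary: A \<delta>0)
  case (Cons t \<delta>)
  then show ?case by (cases "\<delta> = []") (auto simp: rel_path_Cons)
qed simp

lemma act_inverse_rels:
  assumes "rel_path \<Gamma> \<delta>" "\<delta> \<noteq> []"
  shows "act \<Gamma> (map Inv (rev \<delta>)) (Some (map Rel \<delta>, \<delta>0)) = Some ([Obj (target \<Gamma> (last \<delta>))], \<delta>0)"
  using assms
proof (induction \<delta>)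
  case (Cons t \<delta>)
  show ?case
  proof (cases "\<delta> = []")
    case False
    then have c: "rel_path \<Gamma> \<delta>" "t \<in> rels \<Gamma>" "target \<Gamma> t = source \<Gamma> (hd \<delta>)"
      using Cons by (auto simp: rel_path_Cons)
    moreover have "hd (map Rel \<delta>) = (Rel (hd \<delta>) :: ('v, 't) letter)" using False by (simp add: hd_map)
    ultimately have "step \<Gamma> (Inv t) (Some (map Rel (t # \<delta>), \<delta>0)) = Some (map Rel \<delta>, \<delta>0)"
      using False T0_nonempty[OF net source_target_T0(2), of t] by (simp add: prepend_def)
    then show ?thesis using Cons c False by simp
  qed simp
qed simp

lemma act_path_obj:
  assumes "rpath \<Gamma> \<gamma>"
  shows "act \<Gamma> \<gamma> (Some ([Obj (path_target \<Gamma> \<gamma>)], \<delta>)) = Some (\<gamma>, \<delta>)"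
proof -
  obtain xs x where g: "\<gamma> = xs @ [x]" using assms by (cases \<gamma> rule: rev_cases) (auto simp: rpath_def)
  have x: "x \<in> fwd_letters \<Gamma>" using assms by (simp add: g rpath_def)
  then have "ltarget \<Gamma> x \<noteq> {}" using T0_nonempty[OF net] fwd_nz lsource_ltarget_T0(2) by blast
  then have "step \<Gamma> x (Some ([Obj (ltarget \<Gamma> x)], \<delta>)) = Some ([x], \<delta>)"
    using x by (simp add: fwd_step prepend_def)
  then show ?thesis using act_path_append[of xs "[x]"] assms by (simp add: g path_target_def)
qed

text \<open>A normal form can be read off from the action of its word on the members of \<open>T\<^sup>0\<close>. As the action
depends on the class of the word only, this makes normal forms unique.\<close>

lemma act_nf_word_obj:
  assumes "proper \<Gamma> (Some (\<gamma>, \<delta>))"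
  shows "act \<Gamma> (nf_word (Some (\<gamma>, \<delta>))) (Some ([Obj A], [])) =
    (if A = source \<Gamma> (hd \<delta>) then Some (\<gamma>, \<delta>) else None)"
proof -
  have "rpath \<Gamma> \<gamma>" "rel_path \<Gamma> \<delta>" "\<delta> \<noteq> []" "path_target \<Gamma> \<gamma> = target \<Gamma> (last \<delta>)"
    using assms by auto
  then show ?thesis using act_path_obj[of \<gamma> \<delta>] act_inverse_obj[of \<delta> A "[]"] by simp
qed

lemma nf_class_eq_Some:
  assumes "proper \<Gamma> (Some (\<gamma>, \<delta>))" "proper \<Gamma> q" "nf_class \<Gamma> (Some (\<gamma>, \<delta>)) = nf_class \<Gamma> q"
  shows "q = Some (\<gamma>, \<delta>)"
proof -
  let ?o = "Some ([Obj (source \<Gamma> (hd \<delta>))], [])"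
  have "source \<Gamma> (hd \<delta>) \<in> T0 \<Gamma>"
    using assms(1) by (cases \<delta>) (simp_all add: rel_path_def)
  then have "normal \<Gamma> ?o" by (simp add: rpath_def fwd_letters_def rel_path_def)
  moreover have "word_eq \<Gamma> (nf_word (Some (\<gamma>, \<delta>))) (nf_word q)"
    using assms(3) nf_word_free[OF net proper_normal[OF assms(1)]]
    unfolding nf_class_def by (simp only: word_class_eq_iff)
  ultimately have "act \<Gamma> (nf_word (Some (\<gamma>, \<delta>))) ?o = act \<Gamma> (nf_word q) ?o"
    by (intro act_word_eq[OF net])
  then have e: "act \<Gamma> (nf_word q) ?o = Some (\<gamma>, \<delta>)"
    unfolding act_nf_word_obj[OF assms(1)] by simp
  show ?thesis
  proof (cases q rule: nform_cases)
    case (2 \<gamma>' \<delta>')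
    show ?thesis using e unfolding 2 act_nf_word_obj[OF assms(2)[unfolded 2]] by (simp split: if_splits)
  qed (use e in simp)
qed

lemma nf_class_eq_iff:
  assumes "proper \<Gamma> p" "proper \<Gamma> q"
  shows "nf_class \<Gamma> p = nf_class \<Gamma> q \<longleftrightarrow> p = q"
proof (cases p rule: nform_cases)
  case 1
  show ?thesis
  proof (cases q rule: nform_cases)
    case (2 \<gamma> \<delta>)
    then show ?thesis using nf_class_eq_Some[of \<gamma> \<delta> p] assms 1 by metis
  qed (use 1 in simp)
next
  case (2 \<gamma> \<delta>)
  then show ?thesis using nf_class_eq_Some[of \<gamma> \<delta> q] assms by metis
qed

end

section \<open>The two semigroups in terms of normal forms\<close>

lemma rpath_iff: "rpath \<Gamma> \<alpha> \<longleftrightarrow> nonzero_path \<Gamma> \<alpha> \<and> reduced_path \<Gamma> \<alpha>"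
  unfolding rpath_def nonzero_path_def reduced_path_def fwd_letters_def reduced_pair_def
      successively_conv_nth by blast

lemma RP_nonzero: "RP \<Gamma> - {[Zero]} = {\<alpha>. rpath \<Gamma> \<alpha>}"
proof -
  have "\<not> rpath \<Gamma> [Zero]" by (auto simp: rpath_def fwd_letters_def)
  then show ?thesis unfolding RP_def rpath_iff[symmetric] by blast
qed

lemma rpath_map_Rel:
  assumes "network \<Gamma>" "rel_path \<Gamma> \<delta>" "\<delta> \<noteq> []"
  shows "rpath \<Gamma> (map Rel \<delta>)"
  using assms(2,3)
proof (induction \<delta>)
  case (Cons t \<delta>)
  then show ?case
    using T0_nonempty[OF assms(1) source_target_T0(2), of t]
    by (cases "\<delta> = []") (auto simp: rel_path_Cons rpath_Cons reduced_pair_def fwd_letters_def hd_map)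
qed simp

text \<open>Linearity of paths, stated for use with list recursion.\<close>

definition linked :: "('v, 't) network_data \<Rightarrow> ('v, 't) letter list \<Rightarrow> bool" where
  "linked \<Gamma> \<gamma> \<longleftrightarrow> successively (\<lambda>x y. ltarget \<Gamma> x = lsource \<Gamma> y) \<gamma>"

text \<open>In a reduced linear path of length at least two, a letter from \<open>T\<^sup>0\<close> would be the range of its
predecessor or the source of its successor, which reducedness forbids.\<close>

lemma linked_cases:
  assumes "rpath \<Gamma> \<gamma>" "linked \<Gamma> \<gamma>"
  shows "(\<exists>A. \<gamma> = [Obj A]) \<or> (\<exists>\<delta>. \<gamma> = map Rel \<delta> \<and> rel_path \<Gamma> \<delta>)"
  using assms
proof (induction \<gamma>)
  case (Cons x \<gamma>)
  show ?case
  proof (cases "\<gamma> = []")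
    case True
    with Cons.prems show ?thesis
      by (auto simp: rpath_Cons fwd_letters_def rel_path_def intro: exI[of _ "[_]"])
  next
    case False
    then have h: "rpath \<Gamma> \<gamma>" "linked \<Gamma> \<gamma>" "x \<in> fwd_letters \<Gamma>" "reduced_pair \<Gamma> x (hd \<gamma>)"
      "ltarget \<Gamma> x = lsource \<Gamma> (hd \<gamma>)"
      using Cons.prems by (auto simp: rpath_Cons linked_def successively_Cons)
    then obtain t where t: "x = Rel t" "t \<in> rels \<Gamma>"
      by (auto simp: fwd_letters_def reduced_pair_def)
    from Cons.IH[OF h(1,2)] obtain \<delta> where d: "\<gamma> = map Rel \<delta>" "rel_path \<Gamma> \<delta>"
      using h(4,5) by (auto simp: reduced_pair_def)
    then have "rel_path \<Gamma> (t # \<delta>)" using h(5) t False by (auto simp: rel_path_Cons hd_map)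
    then show ?thesis using d t by (metis list.simps(9))
  qed
qed (simp add: rpath_def)

lemma RLP_rels: "RLP \<Gamma> - T0_paths \<Gamma> = {map Rel \<delta> |\<delta>. \<delta> \<noteq> [] \<and> rel_path \<Gamma> \<delta>}" if net: "network \<Gamma>"
proof -
  have RLP: "RLP \<Gamma> = {\<gamma>. rpath \<Gamma> \<gamma> \<and> linked \<Gamma> \<gamma>}"
    unfolding RLP_def rpath_iff linked_def linear_path_def successively_conv_nth by blast
  show ?thesis
  proof (intro equalityI subsetI)
    fix \<gamma> assume "\<gamma> \<in> RLP \<Gamma> - T0_paths \<Gamma>"
    then have g: "rpath \<Gamma> \<gamma>" "linked \<Gamma> \<gamma>" "\<gamma> \<notin> T0_paths \<Gamma>" by (auto simp: RLP)
    have "\<gamma> \<noteq> [Obj A]" for A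
    proof
      assume "\<gamma> = [Obj A]"
      then show False using g(1,3) by (auto simp: rpath_def fwd_letters_def T0_paths_def)
    qed
    then show "\<gamma> \<in> {map Rel \<delta> |\<delta>. \<delta> \<noteq> [] \<and> rel_path \<Gamma> \<delta>}"
      using linked_cases[OF g(1,2)] g(1) by (auto simp: rpath_def)
  next
    fix \<gamma> :: "('a, 'b) letter list" assume "\<gamma> \<in> {map Rel \<delta> |\<delta>. \<delta> \<noteq> [] \<and> rel_path \<Gamma> \<delta>}"
    then obtain \<delta> where d: "\<gamma> = map Rel \<delta>" "\<delta> \<noteq> []" "rel_path \<Gamma> \<delta>" by auto
    then have "linked \<Gamma> \<gamma>" by (simp add: linked_def rel_path_def successively_map)
    moreover have "\<gamma> \<notin> T0_paths \<Gamma>" using d by (auto simp: T0_paths_def)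
    ultimately show "\<gamma> \<in> RLP \<Gamma> - T0_paths \<Gamma>" using rpath_map_Rel[OF net d(3,2)] d(1) by (simp add: RLP)
  qed
qed

lemma path_inv_map_Rel [simp]: "path_inv (map Rel \<delta>) = map Inv (rev \<delta>)"
  by (simp add: path_inv_def rev_map comp_def)

lemma path_target_map_Rel [simp]: "\<delta> \<noteq> [] \<Longrightarrow> path_target \<Gamma> (map Rel \<delta>) = target \<Gamma> (last \<delta>)"
  by (simp add: path_target_def last_map)

lemma S_net_nf_class:
  assumes "network \<Gamma>"
  shows "S_net \<Gamma> = nf_class \<Gamma> ` {p. proper \<Gamma> p}"
proof (intro equalityI subsetI)
  fix a assume "a \<in> S_net \<Gamma>"
  then consider "a = word_class \<Gamma> [Zero]"
    | \<alpha> \<delta> where "a = word_class \<Gamma> (\<alpha> @ path_inv (map Rel \<delta>))" "rpath \<Gamma> \<alpha>" "\<delta> \<noteq> []" "rel_path \<Gamma> \<delta>"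
        "path_target \<Gamma> \<alpha> = path_target \<Gamma> (map Rel \<delta>)"
    unfolding S_net_def RP_nonzero RLP_rels[OF assms] by blast
  then show "a \<in> nf_class \<Gamma> ` {p. proper \<Gamma> p}"
  proof cases
    case 1
    then show ?thesis by (intro image_eqI[of _ _ None]) (simp_all add: nf_class_def)
  next
    case (2 \<alpha> \<delta>)
    then show ?thesis by (intro image_eqI[of _ _ "Some (\<alpha>, \<delta>)"]) (simp_all add: nf_class_def)
  qed
next
  fix a assume "a \<in> nf_class \<Gamma> ` {p. proper \<Gamma> p}"
  then obtain p where p: "a = nf_class \<Gamma> p" "proper \<Gamma> p" by auto
  show "a \<in> S_net \<Gamma>"
  proof (cases p rule: nform_cases)
    case 1
    then show ?thesis using p by (simp add: S_net_def nf_class_def)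
  next
    case (2 \<alpha> \<delta>)
    then have "a = word_class \<Gamma> (\<alpha> @ path_inv (map Rel \<delta>))" "rpath \<Gamma> \<alpha>" "\<delta> \<noteq> []" "rel_path \<Gamma> \<delta>"
        "path_target \<Gamma> \<alpha> = path_target \<Gamma> (map Rel \<delta>)"
      using p by (simp_all add: nf_class_def)
    then show ?thesis unfolding S_net_def RP_nonzero RLP_rels[OF assms] by blast
  qed
qed

definition rel_nf :: "('v, 't) network_data \<Rightarrow> ('v, 't) nform set" where
  "rel_nf \<Gamma> = {p. proper \<Gamma> p \<and> (\<forall>\<gamma> \<delta>. p = Some (\<gamma>, \<delta>) \<longrightarrow> (\<exists>\<alpha>. \<alpha> \<noteq> [] \<and> rel_path \<Gamma> \<alpha> \<and> \<gamma> = map Rel \<alpha>))}"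

lemma R_net_nf_class:
  assumes "network \<Gamma>"
  shows "R_net \<Gamma> = nf_class \<Gamma> ` rel_nf \<Gamma>"
proof (intro equalityI subsetI)
  fix a assume "a \<in> R_net \<Gamma>"
  then consider "a = word_class \<Gamma> [Zero]"
    | \<alpha> \<delta> where "a = word_class \<Gamma> (map Rel \<alpha> @ path_inv (map Rel \<delta>))" "\<alpha> \<noteq> []" "rel_path \<Gamma> \<alpha>"
        "\<delta> \<noteq> []" "rel_path \<Gamma> \<delta>" "path_target \<Gamma> (map Rel \<alpha>) = path_target \<Gamma> (map Rel \<delta>)"
    unfolding R_net_def RLP_rels[OF assms] by blast
  then show "a \<in> nf_class \<Gamma> ` rel_nf \<Gamma>"
  proof cases
    case 1
    then show ?thesis by (intro image_eqI[of _ _ None]) (simp_all add: nf_class_def rel_nf_def)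
  next
    case (2 \<alpha> \<delta>)
    then show ?thesis using rpath_map_Rel[OF assms, of \<alpha>]
      by (intro image_eqI[of _ _ "Some (map Rel \<alpha>, \<delta>)"]) (auto simp: nf_class_def rel_nf_def)
  qed
next
  fix a assume "a \<in> nf_class \<Gamma> ` rel_nf \<Gamma>"
  then obtain p where p: "a = nf_class \<Gamma> p" "p \<in> rel_nf \<Gamma>" by auto
  show "a \<in> R_net \<Gamma>"
  proof (cases p rule: nform_cases)
    case 1
    then show ?thesis using p by (simp add: R_net_def nf_class_def)
  next
    case (2 \<gamma> \<delta>)
    then obtain \<alpha> where a: "\<alpha> \<noteq> []" "rel_path \<Gamma> \<alpha>" "\<gamma> = map Rel \<alpha>"
      using p by (auto simp: rel_nf_def)
    then have "a = word_class \<Gamma> (map Rel \<alpha> @ path_inv (map Rel \<delta>))" "\<delta> \<noteq> []" "rel_path \<Gamma> \<delta>"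
        "path_target \<Gamma> (map Rel \<alpha>) = path_target \<Gamma> (map Rel \<delta>)"
      using p 2 by (simp_all add: nf_class_def rel_nf_def)
    moreover have "a \<in> S_net \<Gamma>" using p by (auto simp: S_net_nf_class[OF assms] rel_nf_def)
    ultimately show ?thesis using a unfolding R_net_def RLP_rels[OF assms] by blast
  qed
qed

context
  fixes \<Gamma> :: "('v, 't) network_data"
  assumes net: "network \<Gamma>"
begin

lemma proper_mult:
  assumes "proper \<Gamma> p" "proper \<Gamma> q" shows "proper \<Gamma> (act \<Gamma> (nf_word p) q)"
  using proper_act[OF net nf_word_letters[OF net proper_normal[OF assms(1)]] assms(2)] .

lemma semigroup_nf_class:
  assumes "P \<subseteq> {p. proper \<Gamma> p}" "\<And>p q. p \<in> P \<Longrightarrow> q \<in> P \<Longrightarrow> act \<Gamma> (nf_word p) q \<in> P"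
  shows "semigroup_on (nf_class \<Gamma> ` P) (Q_mult \<Gamma>)"
proof -
  have n: "normal \<Gamma> p" if "p \<in> P" for p using that assms(1) proper_normal by blast
  have closed: "Q_mult \<Gamma> a b \<in> nf_class \<Gamma> ` P" if "a \<in> nf_class \<Gamma> ` P" "b \<in> nf_class \<Gamma> ` P" for a b
    using that assms(2) n by (auto simp: Q_mult_nf_class[OF net])
  have "nf_class \<Gamma> ` P \<subseteq> Q_carrier \<Gamma>"
    using n nf_word_free[OF net] by (auto simp: nf_class_def Q_carrier_def)
  then show ?thesis
    unfolding semigroup_on_def
  proof (intro conjI ballI)
    fix a b c assume "a \<in> nf_class \<Gamma> ` P" "b \<in> nf_class \<Gamma> ` P" "c \<in> nf_class \<Gamma> ` P"
    then have "a \<in> Q_carrier \<Gamma>" "b \<in> Q_carrier \<Gamma>" "c \<in> Q_carrier \<Gamma>"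
      using \<open>nf_class \<Gamma> ` P \<subseteq> Q_carrier \<Gamma>\<close> by blast+
    then show "Q_mult \<Gamma> (Q_mult \<Gamma> a b) c = Q_mult \<Gamma> a (Q_mult \<Gamma> b c)"
      using semigroup_Q[of \<Gamma>] by (simp add: semigroup_on_def)
  qed (rule closed)
qed

text \<open>This is the matching condition under which a path \<open>\<alpha>\<close> with \<open>r(\<alpha>) = r(\<delta>)\<close> acts injectively.\<close>

lemma source_after_inverse:
  assumes "rel_path \<Gamma> \<delta>" "\<delta> \<noteq> []" "normal \<Gamma> q" "act \<Gamma> (map Inv (rev \<delta>)) q = Some (\<kappa>, \<epsilon>)"
  shows "rpath \<Gamma> \<kappa> \<and> lsource \<Gamma> (hd \<kappa>) = target \<Gamma> (last \<delta>)"
proof -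
  obtain \<delta>0 t where d: "\<delta> = \<delta>0 @ [t]" using assms(2) by (cases \<delta> rule: rev_cases) auto
  define r where "r = act \<Gamma> (map Inv (rev \<delta>0)) q"
  have t: "t \<in> rels \<Gamma>" "rel_path \<Gamma> \<delta>0" using assms(1) by (auto simp: d rel_path_snoc)
  have nr: "normal \<Gamma> r" unfolding r_def using t assms(3)
    by (intro normal_act[OF net]) (auto simp: rel_path_def letters_def)
  have s: "step \<Gamma> (Inv t) r = Some (\<kappa>, \<epsilon>)" using assms(4) by (simp add: d r_def)
  obtain \<gamma> \<eta> where r: "r = Some (\<gamma>, \<eta>)" using s by (cases r rule: nform_cases) auto
  show ?thesis using step_props[OF net _ nr[unfolded r] s[unfolded r]] t by (auto simp: d)
qed

lemma step_matching:
  assumes "x \<in> fwd_letters \<Gamma>" "rpath \<Gamma> \<kappa>" "lsource \<Gamma> (hd \<kappa>) = ltarget \<Gamma> x"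
  shows "step \<Gamma> x (Some (\<kappa>, \<delta>)) =
    Some (case x of Rel t \<Rightarrow> x # (if hd \<kappa> = Obj (ltarget \<Gamma> x) then tl \<kappa> else \<kappa>) | _ \<Rightarrow> \<kappa>, \<delta>)"
proof -
  have "ltarget \<Gamma> x \<noteq> {}"
    using T0_nonempty[OF net] fwd_nz[OF assms(1)] lsource_ltarget_T0(2) by blast
  moreover have "x = Obj (ltarget \<Gamma> x)" if "\<forall>t. x \<noteq> Rel t"
    using that assms(1) by (auto simp: fwd_letters_def)
  ultimately show ?thesis
    using assms prepend_absorb[OF net, of "ltarget \<Gamma> x" \<kappa> \<delta>]
    by (auto simp: fwd_letters_def prepend_def)
qed

text \<open>Injectivity fails without the condition on the sources: \<open>t\<close> sends both \<open>r(t)\<kappa>\<close> and \<open>\<kappa>\<close> to \<open>t\<kappa>\<close> if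
\<open>s(\<kappa>)\<close> meets \<open>r(t)\<close> without being equal to it.\<close>

lemma step_matching_inj:
  assumes "x \<in> fwd_letters \<Gamma>"
    and "rpath \<Gamma> \<kappa>1" "lsource \<Gamma> (hd \<kappa>1) = ltarget \<Gamma> x"
    and "rpath \<Gamma> \<kappa>2" "lsource \<Gamma> (hd \<kappa>2) = ltarget \<Gamma> x"
    and "step \<Gamma> x (Some (\<kappa>1, \<delta>1)) = step \<Gamma> x (Some (\<kappa>2, \<delta>2))"
  shows "Some (\<kappa>1, \<delta>1) = Some (\<kappa>2, \<delta>2)"
proof -
  \<comment> \<open>A path with leading letter \<open>r(x)\<close> and its tail cannot both have source \<open>r(x)\<close>.\<close>
  have no: "\<not> (hd \<kappa> = Obj (ltarget \<Gamma> x) \<and> tl \<kappa> = \<kappa>')"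
    if "rpath \<Gamma> \<kappa>" "rpath \<Gamma> \<kappa>'" "lsource \<Gamma> (hd \<kappa>') = ltarget \<Gamma> x" for \<kappa> \<kappa>'
  proof
    assume "hd \<kappa> = Obj (ltarget \<Gamma> x) \<and> tl \<kappa> = \<kappa>'"
    then have "\<kappa> = Obj (ltarget \<Gamma> x) # \<kappa>'" "\<kappa>' \<noteq> []"
      using that by (cases \<kappa>; auto simp: rpath_def)+
    then show False using that by (auto simp: rpath_Cons reduced_pair_def)
  qed
  have ne: "\<kappa>1 \<noteq> []" "\<kappa>2 \<noteq> []" using assms(2,4) by (auto simp: rpath_def)
  note eq = assms(6)[unfolded step_matching[OF assms(1-3)] step_matching[OF assms(1,4,5)]]
  show ?thesis
  proof (cases x)
    case (Rel t)
    then show ?thesis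
      using eq no[OF assms(2,4,5)] no[OF assms(4,2,3)] ne
      by (auto split: if_splits intro: list.expand)
  qed (use eq in simp_all)
qed

text \<open>Only the last letter of \<open>\<alpha>\<close> interacts with the argument. The result begins with that letter or with a
relation of the same source, so the remaining letters of \<open>\<alpha>\<close> are merely put in front, and the claim
reduces to injectivity of a single step.\<close>

lemma act_path_cancel:
  assumes "rpath \<Gamma> \<alpha>"
    and z1: "\<And>\<kappa> \<epsilon>. z1 = Some (\<kappa>, \<epsilon>) \<Longrightarrow> rpath \<Gamma> \<kappa> \<and> lsource \<Gamma> (hd \<kappa>) = path_target \<Gamma> \<alpha>"
    and z2: "\<And>\<kappa> \<epsilon>. z2 = Some (\<kappa>, \<epsilon>) \<Longrightarrow> rpath \<Gamma> \<kappa> \<and> lsource \<Gamma> (hd \<kappa>) = path_target \<Gamma> \<alpha>"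
    and eq: "act \<Gamma> \<alpha> z1 = act \<Gamma> \<alpha> z2"
  shows "z1 = z2"
proof -
  obtain xs x where a: "\<alpha> = xs @ [x]" using assms(1) by (cases \<alpha> rule: rev_cases) (auto simp: rpath_def)
  have x: "x \<in> fwd_letters \<Gamma>" using assms(1) by (simp add: a rpath_def)
  have ex: "\<exists>w. step \<Gamma> x (Some (\<kappa>, \<epsilon>)) = Some (w, \<epsilon>) \<and> act \<Gamma> \<alpha> (Some (\<kappa>, \<epsilon>)) = Some (xs @ w, \<epsilon>)"
    if k: "rpath \<Gamma> \<kappa> \<and> lsource \<Gamma> (hd \<kappa>) = path_target \<Gamma> \<alpha>" for \<kappa> \<epsilon>
  proof -
    have k': "rpath \<Gamma> \<kappa>" "lsource \<Gamma> (hd \<kappa>) = ltarget \<Gamma> x"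
      using k by (auto simp: a path_target_def)
    define w where "w = (case x of Rel t \<Rightarrow> x # (if hd \<kappa> = Obj (ltarget \<Gamma> x) then tl \<kappa> else \<kappa>) | _ \<Rightarrow> \<kappa>)"
    have s: "step \<Gamma> x (Some (\<kappa>, \<epsilon>)) = Some (w, \<epsilon>)"
      unfolding w_def by (rule step_matching[OF x k'])
    have w: "rpath \<Gamma> w" "lsource \<Gamma> (hd w) = lsource \<Gamma> x"
      using prepend_props[OF net x k'(1), of \<epsilon> w \<epsilon>] s x by (auto simp: fwd_step)
    then have hd: "hd w \<in> fwd_letters \<Gamma>" "w \<noteq> []" by (cases w; simp add: rpath_def)+
    have hdw: "hd w = x \<or> (\<exists>u. hd w = Rel u)"
      using x hd(1) w(2) by (auto simp: fwd_letters_def w_def)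
    have "reduced_pair \<Gamma> (last xs) (hd w)" if "xs \<noteq> []"
      using that assms(1) hdw w(2) by (auto simp: a rpath_def successively_append_iff reduced_pair_def)
    then have "rpath \<Gamma> (xs @ w)"
      using assms(1) w(1) hd(2) unfolding a rpath_def
      by (cases "xs = []") (simp_all add: successively_append_iff)
    from act_path_append[OF net this hd(2)] s show ?thesis by (simp add: a)
  qed
  show ?thesis
  proof (cases z1 rule: nform_cases)
    case 1
    show ?thesis
    proof (cases z2 rule: nform_cases)
      case (2 \<kappa> \<epsilon>)
      obtain w where "act \<Gamma> \<alpha> z2 = Some (xs @ w, \<epsilon>)"
        using ex[OF z2[OF 2], of \<epsilon>] unfolding 2 by blast
      then show ?thesis using eq 1 by simp
    qed (use 1 in simp)
  next
    case p: (2 \<kappa>1 \<epsilon>1)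
    obtain w1 where w1: "step \<Gamma> x z1 = Some (w1, \<epsilon>1)" "act \<Gamma> \<alpha> z1 = Some (xs @ w1, \<epsilon>1)"
      using ex[OF z1[OF p], of \<epsilon>1] unfolding p by blast
    show ?thesis
    proof (cases z2 rule: nform_cases)
      case 1
      then show ?thesis using eq w1 by simp
    next
      case q: (2 \<kappa>2 \<epsilon>2)
      obtain w2 where w2: "step \<Gamma> x z2 = Some (w2, \<epsilon>2)" "act \<Gamma> \<alpha> z2 = Some (xs @ w2, \<epsilon>2)"
        using ex[OF z2[OF q], of \<epsilon>2] unfolding q by blast
      have "step \<Gamma> x z1 = step \<Gamma> x z2" using eq w1 w2 by simp
      then show ?thesis
        using step_matching_inj[OF x, of \<kappa>1 \<kappa>2 \<epsilon>1 \<epsilon>2] z1[OF p] z2[OF q]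
        by (simp add: p q a path_target_def)
    qed
  qed
qed

text \<open>This says \<open>(\<alpha>\<beta>\<inverse>)(\<beta>\<beta>\<inverse>) = \<alpha>\<beta>\<inverse>\<close>; for \<open>\<alpha> = \<beta>\<close> it shows that \<open>\<beta>\<beta>\<inverse>\<close> is idempotent.\<close>

lemma act_idempotent:
  assumes "proper \<Gamma> (Some (\<alpha>, \<beta>))"
  shows "act \<Gamma> (nf_word (Some (\<alpha>, \<beta>))) (Some (map Rel \<beta>, \<beta>)) = Some (\<alpha>, \<beta>)"
proof -
  have h: "rpath \<Gamma> \<alpha>" "rel_path \<Gamma> \<beta>" "\<beta> \<noteq> []" "path_target \<Gamma> \<alpha> = target \<Gamma> (last \<beta>)"
    using assms by auto
  show ?thesis
    using act_inverse_rels[OF net h(2,3), of \<beta>] act_path_obj[OF net h(1), of \<beta>] h(4) by simp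
qed

lemma act_left_cancel:
  assumes p: "proper \<Gamma> (Some (\<alpha>, \<beta>))" and q: "normal \<Gamma> q1" "normal \<Gamma> q2"
    and eq: "act \<Gamma> (nf_word (Some (\<alpha>, \<beta>))) q1 = act \<Gamma> (nf_word (Some (\<alpha>, \<beta>))) q2"
  shows "act \<Gamma> (map Inv (rev \<beta>)) q1 = act \<Gamma> (map Inv (rev \<beta>)) q2"
proof (rule act_path_cancel)
  have h: "rpath \<Gamma> \<alpha>" "rel_path \<Gamma> \<beta>" "\<beta> \<noteq> []" "path_target \<Gamma> \<alpha> = target \<Gamma> (last \<beta>)"
    using p by auto
  show "rpath \<Gamma> \<alpha>" by (rule h(1))
  show "rpath \<Gamma> \<kappa> \<and> lsource \<Gamma> (hd \<kappa>) = path_target \<Gamma> \<alpha>"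
    if "act \<Gamma> (map Inv (rev \<beta>)) q1 = Some (\<kappa>, \<epsilon>)" for \<kappa> \<epsilon>
    using source_after_inverse[OF h(2,3) q(1) that] h(4) by simp
  show "rpath \<Gamma> \<kappa> \<and> lsource \<Gamma> (hd \<kappa>) = path_target \<Gamma> \<alpha>"
    if "act \<Gamma> (map Inv (rev \<beta>)) q2 = Some (\<kappa>, \<epsilon>)" for \<kappa> \<epsilon>
    using source_after_inverse[OF h(2,3) q(2) that] h(4) by simp
  show "act \<Gamma> \<alpha> (act \<Gamma> (map Inv (rev \<beta>)) q1) = act \<Gamma> \<alpha> (act \<Gamma> (map Inv (rev \<beta>)) q2)"
    using eq by simp
qed

lemma act_length_mono:
  assumes "set w \<subseteq> letters \<Gamma>" "normal \<Gamma> (Some (\<gamma>, \<delta>))" "act \<Gamma> w (Some (\<gamma>, \<delta>)) = Some (\<gamma>', \<delta>')"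
  shows "length \<delta> \<le> length \<delta>'"
  using assms(1,3)
proof (induction w arbitrary: \<gamma>' \<delta>')
  case (Cons x w)
  define r where "r = act \<Gamma> w (Some (\<gamma>, \<delta>))"
  have s: "step \<Gamma> x r = Some (\<gamma>', \<delta>')" using Cons.prems by (simp add: r_def)
  obtain \<gamma>1 \<delta>1 where r: "r = Some (\<gamma>1, \<delta>1)" using s by (cases r rule: nform_cases) auto
  have n: "normal \<Gamma> (Some (\<gamma>1, \<delta>1))"
    using normal_act[OF net _ assms(2), of w] Cons.prems unfolding r[symmetric] r_def by simp
  have "x \<noteq> Zero" using s by auto
  then have x: "x \<in> nz_letters \<Gamma>" using Cons.prems by (simp add: letters_def)
  have "length \<delta>1 \<le> length \<delta>'" using step_props[OF net x n s[unfolded r]] by auto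
  moreover have "length \<delta> \<le> length \<delta>1" using Cons.IH[of \<gamma>1 \<delta>1] Cons.prems r r_def by simp
  ultimately show ?case by simp
qed simp

text \<open>If \<open>\<delta>\<close> does not grow, then \<open>t\<inverse>\<close> has removed a leading \<open>t\<close>, and \<open>t\<close> restores it.\<close>

lemma step_undo:
  assumes "normal \<Gamma> (Some (\<gamma>, \<delta>))" "t \<in> rels \<Gamma>"
    and "step \<Gamma> (Inv t) (Some (\<gamma>, \<delta>)) = Some (\<kappa>, \<epsilon>)" "length \<epsilon> = length \<delta>"
  shows "step \<Gamma> (Rel t) (Some (\<kappa>, \<epsilon>)) = Some (\<gamma>, \<delta>)"
proof -
  have ne: "target \<Gamma> t \<noteq> {}" using T0_nonempty[OF net source_target_T0(2)] assms(2) .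
  have rp: "rpath \<Gamma> \<gamma>" using assms(1) by simp
  then obtain y ys where g: "\<gamma> = y # ys" by (cases \<gamma>) (auto simp: rpath_def)
  have y: "y = Rel t" using assms(3,4) unfolding g by (auto split: if_splits)
  show ?thesis
  proof (cases ys)
    case Nil
    then show ?thesis using assms(3) ne unfolding g y by (auto simp: prepend_def)
  next
    case (Cons z zs)
    have "reduced_pair \<Gamma> (Rel t) z" using rp by (simp add: g y Cons rpath_Cons)
    then show ?thesis using assms(3) ne unfolding g y Cons
      by (auto simp: prepend_def reduced_pair_def split: if_splits)
  qed
qed

text \<open>Put differently, \<open>\<beta>\<beta>\<inverse>\<close> fixes every normal form that \<open>\<beta>\<inverse>\<close> does not send to \<open>0\<close> and whose second
component it does not extend.\<close>

lemma act_undo: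
  assumes "rel_path \<Gamma> \<beta>" "normal \<Gamma> (Some (\<gamma>, \<delta>))"
    and "act \<Gamma> (map Inv (rev \<beta>)) (Some (\<gamma>, \<delta>)) = Some (\<kappa>, \<epsilon>)" "length \<epsilon> = length \<delta>"
  shows "act \<Gamma> (map Rel \<beta>) (Some (\<kappa>, \<epsilon>)) = Some (\<gamma>, \<delta>)"
  using assms
proof (induction \<beta> arbitrary: \<gamma> \<delta>)
  case (Cons t \<beta>)
  have t: "t \<in> rels \<Gamma>" "rel_path \<Gamma> \<beta>" using Cons.prems(1)
    by (auto simp: rel_path_def successively_Cons)
  define r where "r = step \<Gamma> (Inv t) (Some (\<gamma>, \<delta>))"
  have s: "act \<Gamma> (map Inv (rev \<beta>)) r = Some (\<kappa>, \<epsilon>)" using Cons.prems(3) by (simp add: r_def)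
  obtain \<gamma>1 \<delta>1 where r: "r = Some (\<gamma>1, \<delta>1)" using s by (cases r rule: nform_cases) auto
  have l: "set (map Inv (rev \<beta>)) \<subseteq> letters \<Gamma>" "Inv t \<in> letters \<Gamma>"
    using t by (auto simp: rel_path_def letters_def)
  have n: "normal \<Gamma> (Some (\<gamma>1, \<delta>1))"
    using normal_step[OF net l(2) Cons.prems(2)] unfolding r[symmetric] r_def .
  have "length \<delta> \<le> length \<delta>1"
    using act_length_mono[of "[Inv t]" \<gamma> \<delta> \<gamma>1 \<delta>1] l Cons.prems(2) r r_def by simp
  moreover have "length \<delta>1 \<le> length \<epsilon>" using act_length_mono[OF l(1) n s[unfolded r]] .
  ultimately have len: "length \<delta>1 = length \<delta>" "length \<epsilon> = length \<delta>1" using Cons.prems(4) by auto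
  have "act \<Gamma> (map Rel \<beta>) (Some (\<kappa>, \<epsilon>)) = Some (\<gamma>1, \<delta>1)"
    by (rule Cons.IH[OF t(2) n s[unfolded r] len(2)])
  then show ?case
    using step_undo[OF Cons.prems(2) t(1) _ len(1)] r r_def by simp
qed simp

lemma proper_idempotent:
  assumes "rel_path \<Gamma> \<beta>" "\<beta> \<noteq> []" shows "proper \<Gamma> (Some (map Rel \<beta>, \<beta>))"
  using assms rpath_map_Rel[OF net] by simp

lemma semigroup_S_net: "semigroup_on (S_net \<Gamma>) (Q_mult \<Gamma>)"
  unfolding S_net_nf_class[OF net] by (rule semigroup_nf_class) (auto simp: proper_mult)

lemma nf_class_mult_eq:
  assumes "proper \<Gamma> p" "proper \<Gamma> q" "proper \<Gamma> r"
  shows "Q_mult \<Gamma> (nf_class \<Gamma> p) (nf_class \<Gamma> q) = nf_class \<Gamma> r \<longleftrightarrow> act \<Gamma> (nf_word p) q = r"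
  using Q_mult_nf_class[OF net] nf_class_eq_iff[OF net] proper_mult assms proper_normal by metis

lemma star_None: "star (S_net \<Gamma>) (Q_mult \<Gamma>) (nf_class \<Gamma> None) = nf_class \<Gamma> None"
proof (rule star_eqI)
  show S: "nf_class \<Gamma> None \<in> S_net \<Gamma>" by (simp add: S_net_nf_class[OF net])
  show z: "Q_mult \<Gamma> (nf_class \<Gamma> None) (nf_class \<Gamma> None) = nf_class \<Gamma> None"
    using nf_class_mult_eq[of None None None] by simp
  show "Lstar (S_net \<Gamma>) (Q_mult \<Gamma>) (nf_class \<Gamma> None) (nf_class \<Gamma> None)"
    by (simp add: Lstar_def)
  fix f assume f: "f \<in> S_net \<Gamma>" "Q_mult \<Gamma> f (nf_class \<Gamma> None) = f"
  then obtain p where p: "f = nf_class \<Gamma> p" "proper \<Gamma> p" by (auto simp: S_net_nf_class[OF net])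
  then show "f = nf_class \<Gamma> None" using f(2) nf_class_mult_eq[of p None p] by simp
qed

text \<open>With \<open>a = \<alpha>\<beta>\<inverse>\<close> and \<open>e = \<beta>\<beta>\<inverse>\<close>, \<open>ax = ay\<close> implies \<open>\<beta>\<inverse>x = \<beta>\<inverse>y\<close> by cancellation of \<open>\<alpha>\<close>, hence
\<open>ex = ey\<close>. For uniqueness let \<open>ef = e\<close> and \<open>fe = f\<close>. Left multiplication never shortens the second
component, so the two equations force the second components of \<open>e\<close> and \<open>f\<close> to have equal length.
Then \<open>\<beta>\<inverse>\<close> does not extend that of \<open>f\<close>, and therefore \<open>e\<close> fixes \<open>f\<close>, that is \<open>f = ef = e\<close>.\<close>

lemma star_Some:
  assumes p: "proper \<Gamma> (Some (\<alpha>, \<beta>))"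
  shows "star (S_net \<Gamma>) (Q_mult \<Gamma>) (nf_class \<Gamma> (Some (\<alpha>, \<beta>))) = nf_class \<Gamma> (Some (map Rel \<beta>, \<beta>))"
proof -
  define a e where "a = Some (\<alpha>, \<beta>)" and "e = Some (map Rel \<beta> :: ('v, 't) letter list, \<beta>)"
  have b: "rel_path \<Gamma> \<beta>" "\<beta> \<noteq> []" using p by auto
  have pa: "proper \<Gamma> a" and pe: "proper \<Gamma> e"
    using p proper_idempotent[OF b] by (simp_all only: a_def e_def)
  have ae: "act \<Gamma> (nf_word a) e = a" and ee: "act \<Gamma> (nf_word e) e = e"
    using act_idempotent[OF p] act_idempotent[OF proper_idempotent[OF b]] by (simp_all only: a_def e_def)
  have S: "nf_class \<Gamma> a \<in> S_net \<Gamma>" "nf_class \<Gamma> e \<in> S_net \<Gamma>" using pa pe by (auto simp: S_net_nf_class[OF net])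
  have Qe: "Q_mult \<Gamma> (nf_class \<Gamma> e) (nf_class \<Gamma> e) = nf_class \<Gamma> e" "Q_mult \<Gamma> (nf_class \<Gamma> a) (nf_class \<Gamma> e) = nf_class \<Gamma> a"
    using nf_class_mult_eq pa pe ae ee by auto
  have "star (S_net \<Gamma>) (Q_mult \<Gamma>) (nf_class \<Gamma> a) = nf_class \<Gamma> e"
  proof (rule star_eqI)
    show "Lstar (S_net \<Gamma>) (Q_mult \<Gamma>) (nf_class \<Gamma> a) (nf_class \<Gamma> e)"
    proof (rule LstarI[OF semigroup_S_net S Qe])
      fix x y assume xy: "x \<in> S_net \<Gamma>" "y \<in> S_net \<Gamma>"
        and eq: "Q_mult \<Gamma> (nf_class \<Gamma> a) x = Q_mult \<Gamma> (nf_class \<Gamma> a) y"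
      obtain q1 q2 where q: "x = nf_class \<Gamma> q1" "proper \<Gamma> q1" "y = nf_class \<Gamma> q2" "proper \<Gamma> q2"
        using xy by (auto simp: S_net_nf_class[OF net])
      have "act \<Gamma> (nf_word a) q1 = act \<Gamma> (nf_word a) q2"
        using eq unfolding q Q_mult_nf_class[OF net proper_normal[OF pa] proper_normal[OF q(2)]]
          Q_mult_nf_class[OF net proper_normal[OF pa] proper_normal[OF q(4)]]
        by (subst (asm) nf_class_eq_iff[OF net proper_mult[OF pa q(2)] proper_mult[OF pa q(4)]])
      from act_left_cancel[OF p proper_normal[OF q(2)] proper_normal[OF q(4)] this[unfolded a_def]]
      have "act \<Gamma> (nf_word e) q1 = act \<Gamma> (nf_word e) q2" by (simp add: e_def)
      then show "Q_mult \<Gamma> (nf_class \<Gamma> e) x = Q_mult \<Gamma> (nf_class \<Gamma> e) y"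
        unfolding q Q_mult_nf_class[OF net proper_normal[OF pe] proper_normal[OF q(2)]]
          Q_mult_nf_class[OF net proper_normal[OF pe] proper_normal[OF q(4)]] by simp
    qed
  next
    fix f assume f: "f \<in> S_net \<Gamma>" "Q_mult \<Gamma> (nf_class \<Gamma> e) f = nf_class \<Gamma> e" "Q_mult \<Gamma> f (nf_class \<Gamma> e) = f"
    then obtain q where q: "f = nf_class \<Gamma> q" "proper \<Gamma> q" by (auto simp: S_net_nf_class[OF net])
    have eq: "act \<Gamma> (nf_word e) q = e" and qe: "act \<Gamma> (nf_word q) e = q"
      using f(2,3) nf_class_mult_eq[OF pe q(2) pe] nf_class_mult_eq[OF q(2) pe q(2)] by (simp_all add: q(1))
    obtain \<gamma> \<delta> where gd: "q = Some (\<gamma>, \<delta>)"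
      using eq by (cases q rule: nform_cases) (auto simp: e_def)
    have "length \<delta> \<le> length \<beta>"
      using act_length_mono[OF nf_word_letters[OF net proper_normal[OF pe]]
          proper_normal[OF q(2), unfolded gd]] eq
      unfolding gd e_def by blast
    moreover have "length \<beta> \<le> length \<delta>"
      using act_length_mono[OF nf_word_letters[OF net proper_normal[OF q(2)]]
          proper_normal[OF pe, unfolded e_def]] qe
      unfolding gd e_def by blast
    ultimately have len: "length \<beta> = length \<delta>" by simp
    define z where "z = act \<Gamma> (map Inv (rev \<beta>)) q"
    have ez: "act \<Gamma> (map Rel \<beta>) z = e" using eq unfolding e_def z_def by simp
    obtain \<kappa> \<epsilon> where z: "z = Some (\<kappa>, \<epsilon>)" using ez by (cases z rule: nform_cases) (auto simp: e_def)
    have inv: "set (map Inv (rev \<beta>)) \<subseteq> letters \<Gamma>" and fwd: "set (map Rel \<beta>) \<subseteq> letters \<Gamma>"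
      using b by (auto simp: rel_path_def letters_def)
    have nz: "normal \<Gamma> z" unfolding z_def
      by (rule normal_act[OF net inv proper_normal[OF q(2)]])
    have "length \<epsilon> \<le> length \<beta>"
      using act_length_mono[OF fwd nz[unfolded z]] ez unfolding z e_def by blast
    moreover have "length \<delta> \<le> length \<epsilon>"
      using act_length_mono[OF inv proper_normal[OF q(2), unfolded gd]] z_def
      unfolding z gd by (metis z)
    ultimately have "length \<epsilon> = length \<delta>" using len by simp
    from act_undo[OF b(1) proper_normal[OF q(2), unfolded gd] z_def[symmetric, unfolded gd z] this]
    show "f = nf_class \<Gamma> e" using ez by (simp add: z gd q(1))
  qed (fact S Qe)+
  then show ?thesis by (simp only: a_def e_def)
qed

section \<open>Closure of the inverse subsemigroup under multiplication\<close>

lemma act_inverse_linked: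
  assumes "set \<beta> \<subseteq> rels \<Gamma>" "normal \<Gamma> (Some (\<gamma>, \<delta>))" "linked \<Gamma> \<gamma>"
    and "act \<Gamma> (map Inv (rev \<beta>)) (Some (\<gamma>, \<delta>)) = Some (\<kappa>, \<epsilon>)"
  shows "linked \<Gamma> \<kappa>"
  using assms
proof (induction \<beta> arbitrary: \<gamma> \<delta>)
  case (Cons t \<beta>)
  define r where "r = step \<Gamma> (Inv t) (Some (\<gamma>, \<delta>))"
  have s: "act \<Gamma> (map Inv (rev \<beta>)) r = Some (\<kappa>, \<epsilon>)" using Cons.prems(4) by (simp add: r_def)
  obtain \<gamma>1 \<delta>1 where r: "r = Some (\<gamma>1, \<delta>1)" using s by (cases r rule: nform_cases) auto
  have l: "Inv t \<in> letters \<Gamma>" using Cons.prems(1) by (auto simp: letters_def)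
  have n: "normal \<Gamma> (Some (\<gamma>1, \<delta>1))"
    using normal_step[OF net l Cons.prems(2)] unfolding r[symmetric] r_def .
  have rp: "rpath \<Gamma> \<gamma>" using Cons.prems(2) by simp
  have r': "step \<Gamma> (Inv t) (Some (\<gamma>, \<delta>)) = Some (\<gamma>1, \<delta>1)" using r r_def by simp
  have "linked \<Gamma> \<gamma>1"
  proof (cases "hd \<gamma> = Rel t \<and> tl \<gamma> \<noteq> []")
    case True
    then obtain z zs where g: "\<gamma> = Rel t # z # zs"
      using rp by (cases \<gamma>; cases "tl \<gamma>") (auto simp: rpath_def)
    then have "rpath \<Gamma> (z # zs)" "lsource \<Gamma> z = target \<Gamma> t" "linked \<Gamma> (z # zs)"
      using rp Cons.prems(3) by (auto simp: rpath_Cons linked_def)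
    then show ?thesis
      using r' prepend_absorb[OF net, of "target \<Gamma> t" "z # zs" \<delta>] Cons.prems(1) by (simp add: g)
  next
    case False
    then have "\<gamma>1 = [Obj (target \<Gamma> t)]" using r' rp by (cases \<gamma>) (auto simp: rpath_def split: if_splits)
    then show ?thesis by (simp add: linked_def)
  qed
  then show ?case using Cons.IH[OF _ n _ s[unfolded r]] Cons.prems(1) by simp
qed simp

text \<open>The factor \<open>\<beta>\<inverse>\<close> leaves a linear first component whose source is \<open>r(\<beta>) = r(\<alpha>)\<close>. It is either that
set alone, which \<open>\<alpha>\<close> absorbs, or a path of relations that continues \<open>\<alpha>\<close> linearly.\<close>

lemma rel_nf_mult:
  assumes "p \<in> rel_nf \<Gamma>" "q \<in> rel_nf \<Gamma>"
  shows "act \<Gamma> (nf_word p) q \<in> rel_nf \<Gamma>"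
proof -
  have pr: "proper \<Gamma> p" "proper \<Gamma> q" using assms by (auto simp: rel_nf_def)
  have "\<exists>g. g \<noteq> [] \<and> rel_path \<Gamma> g \<and> \<gamma> = map Rel g" if res: "act \<Gamma> (nf_word p) q = Some (\<gamma>, \<delta>)" for \<gamma> \<delta>
  proof -
    obtain \<alpha>' \<beta> where p': "p = Some (\<alpha>', \<beta>)" using res by (cases p rule: nform_cases) auto
    obtain \<alpha> where a: "\<alpha> \<noteq> []" "rel_path \<Gamma> \<alpha>" "\<alpha>' = map Rel \<alpha>"
      using assms(1) p' by (auto simp: rel_nf_def)
    obtain \<mu>' \<nu> where q': "q = Some (\<mu>', \<nu>)" using res by (cases q rule: nform_cases) auto
    obtain \<mu> where m: "\<mu> \<noteq> []" "rel_path \<Gamma> \<mu>" "\<mu>' = map Rel \<mu>"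
      using assms(2) q' by (auto simp: rel_nf_def)
    have b: "rel_path \<Gamma> \<beta>" "\<beta> \<noteq> []" "target \<Gamma> (last \<alpha>) = target \<Gamma> (last \<beta>)"
      using pr(1) a by (auto simp: p')
    obtain \<kappa> \<epsilon> where z: "act \<Gamma> (map Inv (rev \<beta>)) q = Some (\<kappa>, \<epsilon>)"
      using res by (cases "act \<Gamma> (map Inv (rev \<beta>)) q" rule: nform_cases) (auto simp: p')
    have k: "rpath \<Gamma> \<kappa>" "lsource \<Gamma> (hd \<kappa>) = target \<Gamma> (last \<alpha>)"
      using source_after_inverse[OF b(1,2) proper_normal[OF pr(2)] z] b(3) by auto
    have "linked \<Gamma> \<mu>'" using m by (simp add: linked_def rel_path_def successively_map)
    then have "linked \<Gamma> \<kappa>"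
      using act_inverse_linked[of \<beta> \<mu>' \<nu> \<kappa> \<epsilon>] b(1) proper_normal[OF pr(2)] z
      unfolding q' rel_path_def by blast
    from linked_cases[OF k(1) this] show ?thesis
    proof
      assume "\<exists>A. \<kappa> = [Obj A]"
      then obtain A where A: "\<kappa> = [Obj A]" by blast
      then have "\<kappa> = [Obj (path_target \<Gamma> (map Rel \<alpha>))]" using k(2) a(1) by simp
      then have "\<gamma> = map Rel \<alpha>"
        using act_path_obj[OF net rpath_map_Rel[OF net a(2,1)], of \<epsilon>] z res by (simp add: p' a(3))
      then show ?thesis using a by blast
    next
      assume "\<exists>g. \<kappa> = map Rel g \<and> rel_path \<Gamma> g"
      then obtain g where g: "\<kappa> = map Rel g" "rel_path \<Gamma> g" by blast
      then have ne: "g \<noteq> []" using k(1) by (auto simp: rpath_def)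
      then have "target \<Gamma> (last \<alpha>) = source \<Gamma> (hd g)" using k(2) g by (simp add: hd_map)
      then have ch: "rel_path \<Gamma> (\<alpha> @ g)"
        using a(2) g(2) ne by (auto simp: rel_path_def successively_append_iff)
      then have "rpath \<Gamma> (map Rel \<alpha> @ map Rel g)" using rpath_map_Rel[OF net ch] ne by simp
      from act_path_append[OF net this, of \<epsilon>] have "\<gamma> = map Rel (\<alpha> @ g)"
        using ne z res by (simp add: p' a(3) g(1))
      then show ?thesis using ch a(1) by blast
    qed
  qed
  then show ?thesis using proper_mult[OF pr] unfolding rel_nf_def by blast
qed

end

section \<open>The ideal of elements ending in a dead end\<close>

fun ends_at :: "('v, 't) network_data \<Rightarrow> 'v set \<Rightarrow> ('v, 't) nform \<Rightarrow> bool" where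
  "ends_at \<Gamma> B None = True"
| "ends_at \<Gamma> B (Some (\<gamma>, \<delta>)) = (path_target \<Gamma> \<gamma> = B)"

definition dead_end :: "('v, 't) network_data \<Rightarrow> 'v set \<Rightarrow> bool" where
  "dead_end \<Gamma> B \<longleftrightarrow> (\<forall>A\<in>T0 \<Gamma>. A \<inter> B \<noteq> {} \<longrightarrow> A = B) \<and> (\<forall>u\<in>rels \<Gamma>. source \<Gamma> u \<noteq> B)"

context
  fixes \<Gamma> :: "('v, 't) network_data" and B :: "'v set"
  assumes net: "network \<Gamma>" and B: "dead_end \<Gamma> B"
begin

text \<open>The range of the first component could change only if this component were the source of a relation,
but no relation starts at \<open>B\<close>.\<close>

lemma ends_at_step:
  assumes "x \<in> letters \<Gamma>" "normal \<Gamma> p" "ends_at \<Gamma> B p"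
  shows "ends_at \<Gamma> B (step \<Gamma> x p)"
proof (cases "step \<Gamma> x p" rule: nform_cases)
  case (2 \<gamma>' \<delta>')
  obtain \<gamma> \<delta> where p: "p = Some (\<gamma>, \<delta>)" using 2 by (cases p rule: nform_cases) auto
  have "x \<noteq> Zero" using 2 by auto
  then have x: "x \<in> nz_letters \<Gamma>" using assms(1) by (simp add: letters_def)
  have "path_target \<Gamma> \<gamma> = B" using assms(3) p by simp
  moreover have "\<not> (\<exists>t\<in>rels \<Gamma>. \<gamma> = [Obj (source \<Gamma> t)])"
    using calculation B by (auto simp: path_target_def dead_end_def)
  ultimately have "path_target \<Gamma> \<gamma>' = B"
    using step_props[OF net x assms(2)[unfolded p] 2[unfolded p]] by blast
  then show ?thesis unfolding 2 by simp
qed simp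

lemma ends_at_act:
  "set w \<subseteq> letters \<Gamma> \<Longrightarrow> normal \<Gamma> p \<Longrightarrow> ends_at \<Gamma> B p \<Longrightarrow> ends_at \<Gamma> B (act \<Gamma> w p)"
  by (induction w) (auto simp: ends_at_step normal_act[OF net])

text \<open>A reduced path cannot continue after a relation \<open>t\<close> with range \<open>B\<close>: the next letter would have
source \<open>B\<close>, so it would be a relation starting at \<open>B\<close> or the letter \<open>B\<close>, which \<open>t\<close> absorbs. Hence
\<open>t\<inverse>\<close> yields \<open>0\<close> or a normal form with first component \<open>B\<close>, whatever it acts on.\<close>

lemma ends_at_inverse:
  assumes "t \<in> rels \<Gamma>" "target \<Gamma> t = B" "normal \<Gamma> p"
  shows "ends_at \<Gamma> B (step \<Gamma> (Inv t) p)"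
proof (cases p rule: nform_cases)
  case (2 \<gamma> \<delta>)
  have rp: "rpath \<Gamma> \<gamma>" using assms(3) 2 by simp
  have "\<not> (hd \<gamma> = Rel t \<and> tl \<gamma> \<noteq> [])"
  proof
    assume "hd \<gamma> = Rel t \<and> tl \<gamma> \<noteq> []"
    then obtain z zs where g: "\<gamma> = Rel t # z # zs"
      using rp by (cases \<gamma>; cases "tl \<gamma>") (auto simp: rpath_def)
    then have z: "z \<in> fwd_letters \<Gamma>" "lsource \<Gamma> z \<inter> B \<noteq> {}" "z \<noteq> Obj B"
      using rp assms(2) by (auto simp: rpath_Cons reduced_pair_def)
    then have "lsource \<Gamma> z = B"
      using B fwd_nz[OF z(1)] lsource_ltarget_T0(1) unfolding dead_end_def by blast
    then show False using z(1,3) B by (auto simp: fwd_letters_def dead_end_def)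
  qed
  then show ?thesis using rp assms(2)
    by (cases \<gamma>) (auto simp: 2 path_target_def rpath_def)
qed simp

text \<open>For a right factor in the ideal this is invariance under the action. For a left factor \<open>\<alpha>\<beta>\<inverse>\<close>, the
last relation of \<open>\<beta>\<close> has range \<open>B\<close>, so its inverse brings every element into the ideal, and \<open>\<alpha>\<close>
keeps it there.\<close>

lemma ends_at_mult:
  assumes "proper \<Gamma> p" "proper \<Gamma> q" "ends_at \<Gamma> B p \<or> ends_at \<Gamma> B q"
  shows "ends_at \<Gamma> B (act \<Gamma> (nf_word p) q)"
proof -
  have l: "set (nf_word p) \<subseteq> letters \<Gamma>"
    by (rule nf_word_letters[OF net proper_normal[OF assms(1)]])
  show ?thesis
  proof (cases "ends_at \<Gamma> B q")
    case True
    then show ?thesis using ends_at_act[OF l proper_normal[OF assms(2)]] by simp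
  next
    case False
    then have e: "ends_at \<Gamma> B p" using assms(3) by simp
    show ?thesis
    proof (cases p rule: nform_cases)
      case (2 \<alpha> \<beta>)
      then obtain \<beta>0 t where b: "\<beta> = \<beta>0 @ [t]"
        using assms(1) by (cases \<beta> rule: rev_cases) auto
      have t: "t \<in> rels \<Gamma>" "target \<Gamma> t = B" "rel_path \<Gamma> \<beta>0"
        using assms(1) e by (auto simp: 2 b rel_path_snoc)
      define r where "r = act \<Gamma> (map Inv (rev \<beta>0)) q"
      have r: "normal \<Gamma> r" unfolding r_def using t proper_normal[OF assms(2)]
        by (intro normal_act[OF net]) (auto simp: rel_path_def letters_def)
      have "normal \<Gamma> (step \<Gamma> (Inv t) r)" using t(1) r by (intro normal_step[OF net]) (simp_all add: letters_def)
      moreover have "set \<alpha> \<subseteq> letters \<Gamma>" using l 2 by simp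
      ultimately have "ends_at \<Gamma> B (act \<Gamma> \<alpha> (step \<Gamma> (Inv t) r))"
        using ends_at_inverse[OF t(1,2) r] by (intro ends_at_act)
      then show ?thesis by (simp add: 2 b r_def)
    qed simp
  qed
qed

text \<open>Stated for a set \<open>P\<close> of normal forms that is closed under multiplication, in order to cover
\<open>S\<^sub>\<Gamma>\<close> and \<open>R\<^sub>\<Gamma>\<close> at once.\<close>

lemma nontrivial_Rees_congruence:
  fixes P and t q :: 't
  defines "I \<equiv> nf_class \<Gamma> ` {p \<in> P. ends_at \<Gamma> B p}"
  assumes P: "P \<subseteq> {p. proper \<Gamma> p}" "\<And>p q. p \<in> P \<Longrightarrow> q \<in> P \<Longrightarrow> act \<Gamma> (nf_word p) q \<in> P"
    and el: "None \<in> P" "Some ([Rel t], [t]) \<in> P" "Some ([Rel q], [q]) \<in> P"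
    and tq: "target \<Gamma> t = B" "target \<Gamma> q \<noteq> B"
  shows "sg_congruence (nf_class \<Gamma> ` P) (Q_mult \<Gamma>) (Id_on (nf_class \<Gamma> ` P) \<union> I \<times> I)"
    and "Id_on (nf_class \<Gamma> ` P) \<union> I \<times> I \<noteq> Id_on (nf_class \<Gamma> ` P)"
    and "Id_on (nf_class \<Gamma> ` P) \<union> I \<times> I \<noteq> nf_class \<Gamma> ` P \<times> nf_class \<Gamma> ` P"
proof -
  show "sg_congruence (nf_class \<Gamma> ` P) (Q_mult \<Gamma>) (Id_on (nf_class \<Gamma> ` P) \<union> I \<times> I)"
  proof (rule Rees_congruence)
    show "semigroup_on (nf_class \<Gamma> ` P) (Q_mult \<Gamma>)" by (rule semigroup_nf_class[OF net P])
    show "I \<subseteq> nf_class \<Gamma> ` P" by (auto simp: I_def)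
    fix a c assume "a \<in> I" "c \<in> nf_class \<Gamma> ` P"
    then obtain p r where p: "a = nf_class \<Gamma> p" "p \<in> P" "ends_at \<Gamma> B p" and r: "c = nf_class \<Gamma> r" "r \<in> P"
      by (auto simp: I_def)
    have pr: "proper \<Gamma> p" "proper \<Gamma> r" using p r P(1) by auto
    have "act \<Gamma> (nf_word r) p \<in> {p \<in> P. ends_at \<Gamma> B p}" "act \<Gamma> (nf_word p) r \<in> {p \<in> P. ends_at \<Gamma> B p}"
      using P(2) p r ends_at_mult pr by auto
    then show "Q_mult \<Gamma> c a \<in> I \<and> Q_mult \<Gamma> a c \<in> I"
      unfolding p(1) r(1) Q_mult_nf_class[OF net proper_normal[OF pr(1)] proper_normal[OF pr(2)]]
        Q_mult_nf_class[OF net proper_normal[OF pr(2)] proper_normal[OF pr(1)]] I_def by blast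
  qed
  have inj: "nf_class \<Gamma> p = nf_class \<Gamma> r \<longleftrightarrow> p = r" if "p \<in> P" "r \<in> P" for p r
    using that P(1) by (intro nf_class_eq_iff[OF net]) auto
  have z: "nf_class \<Gamma> None \<in> I" unfolding I_def using el(1) by (intro imageI) simp
  have t: "nf_class \<Gamma> (Some ([Rel t], [t])) \<in> I"
    unfolding I_def using el(2) tq by (intro imageI) (simp add: path_target_def)
  have ne: "nf_class \<Gamma> (Some ([Rel r], [r])) \<noteq> nf_class \<Gamma> None" if "Some ([Rel r], [r]) \<in> P" for r
    using inj[OF that el(1)] by simp
  show "Id_on (nf_class \<Gamma> ` P) \<union> I \<times> I \<noteq> Id_on (nf_class \<Gamma> ` P)"
    using z t ne[OF el(2)] unfolding Id_on_def by blast
  have "nf_class \<Gamma> (Some ([Rel q], [q])) \<notin> I"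
  proof
    assume "nf_class \<Gamma> (Some ([Rel q], [q])) \<in> I"
    then obtain p where "p \<in> P" "ends_at \<Gamma> B p" "nf_class \<Gamma> (Some ([Rel q], [q])) = nf_class \<Gamma> p"
      by (auto simp: I_def)
    then show False using inj[OF el(3)] tq(2) by (auto simp: path_target_def)
  qed
  then have "(nf_class \<Gamma> (Some ([Rel q], [q])), nf_class \<Gamma> None) \<notin> Id_on (nf_class \<Gamma> ` P) \<union> I \<times> I"
    using ne[OF el(3)] by (simp add: Id_on_iff)
  then show "Id_on (nf_class \<Gamma> ` P) \<union> I \<times> I \<noteq> nf_class \<Gamma> ` P \<times> nf_class \<Gamma> ` P"
    using el by blast
qed

end

lemma outdeg_eq_0: "outdeg \<Gamma> A = 0 \<longleftrightarrow> (\<forall>t\<in>rels \<Gamma>. source \<Gamma> t \<noteq> A)"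
proof -
  have "ecard X = 0 \<longleftrightarrow> X = {}" for X :: "'b set"
    by (cases "finite X") (auto simp: ecard_def zero_enat_def)
  then show ?thesis by (auto simp: outdeg_def)
qed

theorem theorem4p8:
  fixes \<Gamma> :: "('v, 't) network_data" and t q :: 't
  assumes "network \<Gamma>"
    and "ecard (rels \<Gamma>) > 1"
    and "t \<in> rels \<Gamma>" and "q \<in> rels \<Gamma>"
    and "outdeg \<Gamma> (target \<Gamma> t) = 0"
    and "target \<Gamma> t \<noteq> target \<Gamma> q"
    and "\<not> (\<exists>A \<in> T0 \<Gamma> - vertex_sets \<Gamma>. target \<Gamma> t \<subseteq> A)"
  shows "\<not> star_congruence_free (S_net \<Gamma>) (Q_mult \<Gamma>) \<and>
         \<not> congruence_free (R_net \<Gamma>) (Q_mult \<Gamma>)"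
proof -
  note net = assms(1)
  let ?B = "target \<Gamma> t" and ?S = "{p. proper \<Gamma> p}"
  have "?B \<in> T0 \<Gamma>" using assms(3) by simp
  then have "?B \<in> vertex_sets \<Gamma>" using assms(7) by blast
  then obtain v where v: "?B = {v}" unfolding vertex_sets_def by blast
  have "A = ?B" if "A \<in> T0 \<Gamma>" "A \<inter> ?B \<noteq> {}" for A
  proof -
    have sub: "?B \<subseteq> A" using that(2) unfolding v by simp
    then have "A \<in> vertex_sets \<Gamma>" using that(1) assms(7) by blast
    then obtain w where "A = {w}" unfolding vertex_sets_def by blast
    then show ?thesis using sub v by simp
  qed
  then have B: "dead_end \<Gamma> ?B"
    using assms(5) by (auto simp: dead_end_def outdeg_eq_0)
  have rel_el: "Some ([Rel u], [u]) \<in> rel_nf \<Gamma>" if "u \<in> rels \<Gamma>" for u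
  proof -
    have c: "rel_path \<Gamma> [u]" using that by (simp add: rel_path_def)
    then have "proper \<Gamma> (Some ([Rel u], [u]))" using proper_idempotent[OF net c] by simp
    then show ?thesis using c by (auto simp: rel_nf_def intro: exI[of _ "[u]"])
  qed
  have R: "rel_nf \<Gamma> \<subseteq> ?S" "None \<in> rel_nf \<Gamma>" by (auto simp: rel_nf_def)
  let ?IS = "nf_class \<Gamma> ` {p \<in> ?S. ends_at \<Gamma> ?B p}"
  let ?\<rho> = "Id_on (nf_class \<Gamma> ` ?S) \<union> ?IS \<times> ?IS"
  have Smult: "act \<Gamma> (nf_word p) r \<in> ?S" if "p \<in> ?S" "r \<in> ?S" for p r
    using that proper_mult[OF net] by simp
  have elS: "None \<in> ?S" "Some ([Rel t], [t]) \<in> ?S" "Some ([Rel q], [q]) \<in> ?S"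
    using R rel_el assms(3,4) by blast+
  \<comment> \<open>The star maps \<open>S\<^sub>\<Gamma>\<close> to itself and the ideal to itself.\<close>
  have star: "star (S_net \<Gamma>) (Q_mult \<Gamma>) (nf_class \<Gamma> p) \<in> nf_class \<Gamma> ` {r \<in> ?S. ends_at \<Gamma> ?B p \<longrightarrow> ends_at \<Gamma> ?B r}"
    if "p \<in> ?S" for p
  proof (cases p rule: nform_cases)
    case 1
    then show ?thesis using star_None[OF net] by auto
  next
    case (2 \<alpha> \<beta>)
    then have b: "rel_path \<Gamma> \<beta>" "\<beta> \<noteq> []" "path_target \<Gamma> \<alpha> = target \<Gamma> (last \<beta>)" using that by auto
    have "star (S_net \<Gamma>) (Q_mult \<Gamma>) (nf_class \<Gamma> p) = nf_class \<Gamma> (Some (map Rel \<beta>, \<beta>))"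
      using star_Some[OF net] that unfolding 2 by simp
    then show ?thesis
      using proper_idempotent[OF net b(1,2)] b by (auto simp: 2 intro!: imageI)
  qed
  have "unary_sg_congruence (S_net \<Gamma>) (Q_mult \<Gamma>) (star (S_net \<Gamma>) (Q_mult \<Gamma>)) ?\<rho>"
    unfolding unary_sg_congruence_def
  proof (intro conjI allI impI)
    show "sg_congruence (S_net \<Gamma>) (Q_mult \<Gamma>) ?\<rho>"
      unfolding S_net_nf_class[OF net]
      by (rule nontrivial_Rees_congruence(1)[OF net B subset_refl Smult elS HOL.refl assms(6)[symmetric]])
    fix a b assume "(a, b) \<in> ?\<rho>"
    then consider p where "p \<in> ?S" "a = nf_class \<Gamma> p" "b = a"
      | p r where "p \<in> ?S" "a = nf_class \<Gamma> p" "ends_at \<Gamma> ?B p" "r \<in> ?S" "b = nf_class \<Gamma> r" "ends_at \<Gamma> ?B r"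
      by auto
    then show "(star (S_net \<Gamma>) (Q_mult \<Gamma>) a, star (S_net \<Gamma>) (Q_mult \<Gamma>) b) \<in> ?\<rho>"
    proof cases
      case 1
      then show ?thesis using star[of p] by auto
    next
      case 2
      then show ?thesis using star[of p] star[of r] by auto
    qed
  qed
  moreover have "?\<rho> \<noteq> Id_on (S_net \<Gamma>)" "?\<rho> \<noteq> S_net \<Gamma> \<times> S_net \<Gamma>"
    unfolding S_net_nf_class[OF net]
    by (rule nontrivial_Rees_congruence(2,3)[OF net B subset_refl Smult elS HOL.refl assms(6)[symmetric]]; assumption)+
  ultimately have "\<not> star_congruence_free (S_net \<Gamma>) (Q_mult \<Gamma>)"
    by (rule not_star_congruence_freeI)
  moreover have "\<not> congruence_free (R_net \<Gamma>) (Q_mult \<Gamma>)"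
  proof -
    let ?IR = "nf_class \<Gamma> ` {p \<in> rel_nf \<Gamma>. ends_at \<Gamma> ?B p}"
    let ?\<sigma> = "Id_on (nf_class \<Gamma> ` rel_nf \<Gamma>) \<union> ?IR \<times> ?IR"
    note elR = R(2) rel_el[OF assms(3)] rel_el[OF assms(4)]
    note Rees = nontrivial_Rees_congruence[OF net B R(1) rel_nf_mult[OF net] elR HOL.refl
        assms(6)[symmetric]]
    have "sg_congruence (nf_class \<Gamma> ` rel_nf \<Gamma>) (Q_mult \<Gamma>) ?\<sigma>" by (rule Rees(1))
    moreover have "?\<sigma> \<noteq> Id_on (nf_class \<Gamma> ` rel_nf \<Gamma>)" by (rule Rees(2))
    moreover have "?\<sigma> \<noteq> nf_class \<Gamma> ` rel_nf \<Gamma> \<times> nf_class \<Gamma> ` rel_nf \<Gamma>" by (rule Rees(3))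
    ultimately show ?thesis unfolding R_net_nf_class[OF net] by (rule not_congruence_freeI)
  qed
  ultimately show ?thesis by blast
qed

end
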